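(* Let $1\le m\le n$, let $A\in\mathbb{R}^{n\times n}$ be invertible, let $W,V\in\mathbb{R}^{n\times m}$ be full-rank matrices with $W^{T}AV$ invertible, and let $b,x_0\in\mathbb{R}^n$. Let $Y\in\mathbb{R}^{n\times(n-m)}$ have as columns $n-m$ linearly independent vectors from $\mathrm{Null}(W^{T}A)$, let $P_2=Y(Y^{T}Y)^{-1}Y^{T}$ and $P_1=I-V(W^{T}AV)^{-1}W^{T}A$. Let $\alpha,\beta>0$, let $s>0$ be a random variable with prior distribution $\mathsf{IG}(\alpha,\beta)$, and suppose that, given $s$, $x\sim\mathcal{N}(x_0,\Sigma_0)$ with $\Sigma_0=VV^{T}+sP_2$. Let $X_{\star 1},\dots,X_{\star k}$ be i.i.d. (given $s$) observations of the random variable $P_1(x-x_0)$, independent of $x$ given $s$, collected as columns of $X\in\mathbb{R}^{n\times k}$. Put $$\widetilde{\alpha}=\alpha+\frac{k(n-m)}{2},\qquad \widetilde{\beta}=\beta+\frac{\mathrm{tr}(X^{T}X)}{2},\qquad \widetilde{x}=x_0+V(W^{T}AV)^{-1}W^{T}(b-Ax_0).$$ Then: 1. The posterior distribution of $s$ given $X$ is $\mathsf{IG}(\widetilde{\alpha},\widetilde{\beta})$. 2. The predictive distribution of $x$ given $W^{T}Ax=W^{T}b$ and $X$ is the multivariate Student distribution $\mathsf{St}_{2\widetilde{\alpha}}\left(\widetilde{x},\frac{\widetilde{\beta}}{\widetilde{\alpha}}P_2\right)$.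
   Context: $\mathsf{IG}(\alpha,\beta)$ is the inverse-gamma distribution with density $\frac{\beta^{\alpha}}{\Gamma(\alpha)}s^{-(\alpha+1)}e^{-\beta/s}$ on $s>0$. For symmetric positive semidefinite $\Sigma\in\mathbb{R}^{n\times n}$ of rank $r$ with spectral decomposition $\Sigma=UDU^{T}$ ($U\in\mathbb{R}^{n\times r}$, $U^TU=I$, $D>0$ diagonal) and $\mu\in\mathbb{R}^n$: $\mathcal{N}(\mu,\Sigma)$ is the (possibly degenerate) Gaussian distribution with mean $\mu$ and covariance $\Sigma$; and $\mathsf{St}_\nu(\mu,\Sigma)$ is the distribution supported on the affine subspace $\mu+\mathrm{Range}(\Sigma)$ with density, with respect to $r$-dimensional Lebesgue measure on that subspace, $$\frac{\Gamma\left(\frac{\nu+r}{2}\right)}{\Gamma\left(\frac{\nu}{2}\right)\sqrt{(\pi\nu)^r\det D}}\left(1+\frac1\nu(x-\mu)^T\Sigma^{\dagger}(x-\mu)\right)^{-\frac{\nu+r}{2}},$$ where $\Sigma^\dagger$ is the Moore–Penrose pseudoinverse. *)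

theory Defs
  imports "HOL-Probability.Probability"
begin

definition inv_gamma :: "real \<Rightarrow> real \<Rightarrow> real measure" where
  "inv_gamma \<alpha> \<beta> = density lborel (\<lambda>s. ennreal (if s > 0
     then \<beta> powr \<alpha> / Gamma \<alpha> * s powr (-(\<alpha> + 1)) * exp (- \<beta> / s) else 0))"

definition std_gaussian :: "(real ^ 'n) measure" where
  "std_gaussian = density lborel (\<lambda>z. ennreal (\<Prod>i\<in>UNIV. std_normal_density (z $ i)))"

(* The law of mu + B Z with Z standard normal and B B^T = Sigma; it does not depend on
   the choice of B.  Such a B exists exactly when Sigma is symmetric positive semidefinite. *)
definition gaussian :: "real ^ 'n \<Rightarrow> real ^ 'n ^ 'n \<Rightarrow> (real ^ 'n) measure" where
  "gaussian \<mu> \<Sigma> = (let B = (SOME B :: real ^ 'n ^ 'n. B ** transpose B = \<Sigma>)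
     in distr std_gaussian borel (\<lambda>z. \<mu> + B *v z))"

(* Moore-Penrose pseudoinverse, by the four Penrose equations. *)
definition pinv :: "real ^ 'n ^ 'm \<Rightarrow> real ^ 'm ^ 'n" where
  "pinv A = (THE G. A ** G ** A = A \<and> G ** A ** G = G \<and>
     transpose (A ** G) = A ** G \<and> transpose (G ** A) = G ** A)"

(* Sigma = U D U^T with U^T U = I and D > 0 diagonal.  The number of columns of U is the rank
   of Sigma and may be zero, so the columns are given as a set E (orthonormal, hence
   distinct and finitely many), and d u is the entry of D belonging to the column u. *)
definition spectral_decomposition ::
    "real ^ 'n ^ 'n \<Rightarrow> (real ^ 'n) set \<Rightarrow> (real ^ 'n \<Rightarrow> real) \<Rightarrow> bool" where
  "spectral_decomposition \<Sigma> E d \<longleftrightarrow>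
     pairwise orthogonal E \<and> (\<forall>u\<in>E. norm u = 1 \<and> d u > 0) \<and>
     \<Sigma> = (\<chi> i j. \<Sum>u\<in>E. u $ i * d u * u $ j)"

(* The base measure, the image of Lebesgue measure on R^r under y |-> mu + U y, is
   r-dimensional Lebesgue measure on mu + Range Sigma.  Neither it nor the product of
   the d u depends on the chosen decomposition. *)
definition student :: "real \<Rightarrow> real ^ 'n \<Rightarrow> real ^ 'n ^ 'n \<Rightarrow> (real ^ 'n) measure" where
  "student \<nu> \<mu> \<Sigma> =
     (let (E, d) = (SOME (E, d). spectral_decomposition \<Sigma> E d); r = rank \<Sigma> in
        density
          (distr (\<Pi>\<^sub>M u\<in>E. lborel) borel (\<lambda>y. \<mu> + (\<Sum>u\<in>E. y u *\<^sub>R u)))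
          (\<lambda>x. ennreal
             (Gamma ((\<nu> + real r) / 2) / (Gamma (\<nu> / 2) * sqrt ((pi * \<nu>) ^ r * (\<Prod>u\<in>E. d u)))
              * (1 + 1 / \<nu> * ((x - \<mu>) \<bullet> (pinv \<Sigma> *v (x - \<mu>)))) powr (-(\<nu> + real r) / 2))))"

(* Inverse of an l x l matrix stored as a function on indices below l, in analogy to
   matrix_inv; l = 0 is allowed. *)
definition fun_matrix_inv :: "nat \<Rightarrow> (nat \<Rightarrow> nat \<Rightarrow> real) \<Rightarrow> nat \<Rightarrow> nat \<Rightarrow> real" where
  "fun_matrix_inv l G = (SOME H. \<forall>i<l. \<forall>j<l.
     (\<Sum>k<l. G i k * H k j) = (if i = j then 1 else 0) \<and>
     (\<Sum>k<l. H i k * G k j) = (if i = j then 1 else 0))"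

(* Y (Y^T Y)^(-1) Y^T, where Y is the matrix with columns y 0, ..., y (l - 1). *)
definition column_projection :: "nat \<Rightarrow> (nat \<Rightarrow> real ^ 'n) \<Rightarrow> real ^ 'n ^ 'n" where
  "column_projection l y = (\<chi> a b. \<Sum>i<l. \<Sum>j<l.
     y i $ a * fun_matrix_inv l (\<lambda>p q. y p \<bullet> y q) i j * y j $ b)"

(* K is a regular conditional distribution of X (with values in N) given Z (with values in L):
   K z is the law of X given Z = z. *)
definition regular_cond_dist ::
    "'w measure \<Rightarrow> 'a measure \<Rightarrow> ('w \<Rightarrow> 'a) \<Rightarrow> 'b measure \<Rightarrow> ('w \<Rightarrow> 'b) \<Rightarrow> ('b \<Rightarrow> 'a measure) \<Rightarrow> bool" where
  "regular_cond_dist M N X L Z K \<longleftrightarrow>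
     X \<in> M \<rightarrow>\<^sub>M N \<and> Z \<in> M \<rightarrow>\<^sub>M L \<and> K \<in> L \<rightarrow>\<^sub>M prob_algebra N \<and>
     (\<forall>A\<in>sets N. \<forall>B\<in>sets L.
        emeasure M {\<omega> \<in> space M. X \<omega> \<in> A \<and> Z \<omega> \<in> B} =
        (\<integral>\<^sup>+ \<omega>. emeasure (K (Z \<omega>)) A * indicator B (Z \<omega>) \<partial>M))"

end

theory Submission
  imports Defs
begin

text \<open>Write \<open>N = span (y ` {..<l})\<close>, which lies in the kernel of \<open>L = W\<^sup>T A\<close>. As \<open>L V\<close> is invertible,
  \<open>\<Sigma>0\<close> is invertible and, given \<open>s = \<sigma>\<close>, \<open>x\<close> has the law of \<open>x0 + V z + b\<close> with \<open>z\<close> standard normal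
  and \<open>b\<close> an independent centred Gaussian on \<open>N\<close> of variance \<open>\<sigma>\<close>. The map \<open>P1\<close> kills \<open>V z\<close> and
  fixes \<open>b\<close>, so the observations are independent copies of \<open>b\<close>, with likelihood proportional to
  \<open>\<sigma> powr (- k * l / 2) * exp (- tr (X\<^sup>T X) / (2 * \<sigma>))\<close>, which is conjugate to the inverse-gamma prior.
  Moreover \<open>L x\<close> determines \<open>z\<close> and is independent of \<open>(s, b)\<close>, so conditioning on it as well leaves
  \<open>b\<close> mixed over the posterior of \<open>s\<close>, and this mixture is the Student distribution.\<close>

section \<open>The inverse-gamma distribution\<close>

text \<open>The definitions contain choices: \<open>gaussian\<close> picks some square root of the
  covariance, and \<open>student\<close> picks some spectral decomposition, of which only the
  eigenvalue and the span of the basis are known. Lebesgue measure on N must therefore be shown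
  independent of the orthonormal basis. The Gaussian side settles this: \<open>\<Sigma>0\<close> is
  invertible, so any two square roots differ by an orthogonal factor and the law of
  \<open>P1 *v (x - x0)\<close> is one fixed measure; its density with respect to the base measure
  of any basis is the same positive function of the norm. All densities can then be taken with
  respect to one base measure on N, although \<open>x\<close> lives in the whole space. The
  parameters of the Student law come from a second use of conjugacy, with a single further residual
  of dimension \<open>l\<close> and squared norm \<open>q\<close>: the exponent
  \<open>\<alpha>' + l / 2\<close> is half of \<open>2 * \<alpha>' + l\<close>, and
  \<open>(\<beta>' + q / 2) / \<beta>'\<close> is \<open>1 + q / \<nu>\<close> rescaled, with
  \<open>\<nu> = 2 * \<alpha>'\<close> and scale \<open>\<beta>' / \<alpha>'\<close>.\<close>

definition inv_gamma_density :: "real \<Rightarrow> real \<Rightarrow> real \<Rightarrow> real" where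
  "inv_gamma_density \<alpha> \<beta> s =
     (if s > 0 then \<beta> powr \<alpha> / Gamma \<alpha> * s powr (- (\<alpha> + 1)) * exp (- \<beta> / s) else 0)"

lemma inv_gamma_eq: "inv_gamma \<alpha> \<beta> = density lborel (\<lambda>s. ennreal (inv_gamma_density \<alpha> \<beta> s))"
  by (simp add: inv_gamma_def inv_gamma_density_def)

lemma inv_gamma_density_nonneg: "\<alpha> > 0 \<Longrightarrow> inv_gamma_density \<alpha> \<beta> s \<ge> 0"
  by (auto simp: inv_gamma_density_def intro!: mult_nonneg_nonneg divide_nonneg_pos Gamma_real_pos)

lemma measurable_inv_gamma_density [measurable]: 
  assumes [measurable]: "b \<in> borel_measurable N" "f \<in> borel_measurable N" 
  shows "(\<lambda>x. inv_gamma_density \<alpha> (b x) (f x)) \<in> borel_measurable N"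
  unfolding inv_gamma_density_def by measurable

lemma space_inv_gamma [simp]: "space (inv_gamma \<alpha> \<beta>) = UNIV"
  and sets_inv_gamma [measurable_cong, simp]: "sets (inv_gamma \<alpha> \<beta>) = sets borel"
  by (simp_all add: inv_gamma_def)

text \<open>The substitution \<open>t = \<beta> / s\<close> reduces the total mass to the Gamma integral.\<close>

lemma nn_integral_inv_gamma_density:
  assumes "\<alpha> > 0" "\<beta> > 0"
  shows "(\<integral>\<^sup>+ s. inv_gamma_density \<alpha> \<beta> s \<partial>lborel) = 1"
proof -
  define f where "f = (\<lambda>t::real. t powr (\<alpha> - 1) / exp t)"
  have img: "(\<lambda>s. \<beta> / s) ` {0<..} = {0<..}"
  proof safe
    fix t :: real assume "t > 0"
    then show "t \<in> (\<lambda>s. \<beta> / s) ` {0<..}"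
      using assms by (intro image_eqI[of _ _ "\<beta> / t"]) auto
  qed (use assms in auto)
  have "(f has_integral Gamma \<alpha>) {0..}"
    unfolding f_def by (rule Gamma_integral_real) fact
  \<comment> \<open>The end point 0 is dropped because \<open>\<beta> / s\<close> maps the open
    half-line onto itself.\<close>
  then have "(f has_integral Gamma \<alpha>) {0<..}"
    by (rule has_integral_spike_set_eq[THEN iffD1, rotated 2]) (auto intro: negligible_subset[of "{0}"])
  then have "f absolutely_integrable_on {0<..} \<and> integral {0<..} f = Gamma \<alpha>"
    by (auto simp: f_def absolutely_integrable_on_def integral_unique intro!: nonnegative_absolutely_integrable_1)
  then have "(\<lambda>s. \<bar>- \<beta> / s\<^sup>2\<bar> * f (\<beta> / s)) absolutely_integrable_on {0<..} \<and>
      integral {0<..} (\<lambda>s. \<bar>- \<beta> / s\<^sup>2\<bar> * f (\<beta> / s)) = Gamma \<alpha>"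
    by (subst has_absolute_integral_change_of_variables_1')
       (use assms img in \<open>auto intro!: derivative_eq_intros inj_onI simp: power2_eq_square\<close>)
  then have "((\<lambda>s. \<bar>- \<beta> / s\<^sup>2\<bar> * f (\<beta> / s)) has_integral Gamma \<alpha>) {0<..}"
    using set_lebesgue_integral_eq_integral(1) integrable_integral by metis
  then have "((\<lambda>s. \<bar>- \<beta> / s\<^sup>2\<bar> * f (\<beta> / s) / Gamma \<alpha>) has_integral Gamma \<alpha> / Gamma \<alpha>) {0<..}"
    by (rule has_integral_divide)
  also have "Gamma \<alpha> / Gamma \<alpha> = 1"
    using Gamma_real_pos[OF assms(1)] by simp
  finally have "((\<lambda>s. inv_gamma_density \<alpha> \<beta> s) has_integral 1) {0<..}"
  proof (rule has_integral_eq[rotated])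
    fix s :: real assume "s \<in> {0<..}"
    then have s: "s > 0" by simp
    have "\<bar>- \<beta> / s\<^sup>2\<bar> * f (\<beta> / s) = (\<beta> * \<beta> powr (\<alpha> - 1)) * (1 / (s\<^sup>2 * s powr (\<alpha> - 1))) * exp (- \<beta> / s)"
      using s assms by (simp add: f_def powr_divide exp_minus field_simps)
    also have "\<beta> * \<beta> powr (\<alpha> - 1) = \<beta> powr \<alpha>"
      using assms by (simp add: powr_mult_base)
    also have "s\<^sup>2 * s powr (\<alpha> - 1) = s powr (\<alpha> + 1)"
      using s by (simp add: powr_add[symmetric] add.commute flip: powr_numeral)
    also have "1 / s powr (\<alpha> + 1) = s powr (- (\<alpha> + 1))"
      using s by (simp only: powr_minus_divide)
    finally show "\<bar>- \<beta> / s\<^sup>2\<bar> * f (\<beta> / s) / Gamma \<alpha> = inv_gamma_density \<alpha> \<beta> s"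
      using s by (simp add: inv_gamma_density_def)
  qed
  from nn_integral_has_integral_lebesgue[OF _ this]
  have "(\<integral>\<^sup>+ s. indicator {0<..} s * inv_gamma_density \<alpha> \<beta> s \<partial>lborel) = 1"
    using assms by (simp add: inv_gamma_density_nonneg)
  also have "(\<integral>\<^sup>+ s. indicator {0<..} s * inv_gamma_density \<alpha> \<beta> s \<partial>lborel)
     = (\<integral>\<^sup>+ s. inv_gamma_density \<alpha> \<beta> s \<partial>lborel)"
    by (intro nn_integral_cong) (auto simp: inv_gamma_density_def indicator_def)
  finally show ?thesis .
qed

lemma prob_space_inv_gamma: "\<alpha> > 0 \<Longrightarrow> \<beta> > 0 \<Longrightarrow> prob_space (inv_gamma \<alpha> \<beta>)"
  by (rule prob_spaceI) (simp add: inv_gamma_eq emeasure_density nn_integral_inv_gamma_density)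

text \<open>The marginal density at a point of squared norm \<open>q\<close> of a \<open>p\<close>-dimensional centred Gaussian
  vector whose variance is inverse-gamma distributed.\<close>

definition inv_gamma_evidence :: "real \<Rightarrow> real \<Rightarrow> real \<Rightarrow> real \<Rightarrow> real" where
  "inv_gamma_evidence \<alpha> \<beta> p q = \<beta> powr \<alpha> * Gamma (\<alpha> + p / 2) /
     (Gamma \<alpha> * (2 * pi) powr (p / 2) * (\<beta> + q / 2) powr (\<alpha> + p / 2))"

lemma inv_gamma_evidence_nonneg: "\<alpha> > 0 \<Longrightarrow> p \<ge> 0 \<Longrightarrow> inv_gamma_evidence \<alpha> \<beta> p q \<ge> 0"
  unfolding inv_gamma_evidence_def
  by (intro divide_nonneg_nonneg mult_nonneg_nonneg less_imp_le[OF Gamma_real_pos]) auto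

text \<open>The exponents of \<open>s\<close> add up to \<open>- (\<alpha> + p / 2 + 1)\<close> and
  the exponentials merge into the rate \<open>\<beta> + q / 2\<close>; the evidence is what remains
  of the normalising constants. The identity serves twice: for all observations together, with
  \<open>p = k * l\<close>, and for one further residual, with \<open>p = l\<close>, where the
  evidence becomes the Student density.\<close>

lemma inv_gamma_density_conjugate:
  assumes "\<alpha> > 0" "\<beta> > 0" "p \<ge> 0" "q \<ge> 0"
  shows "inv_gamma_density \<alpha> \<beta> s * ((2 * pi * s) powr (- p / 2) * exp (- q / (2 * s))) =
    inv_gamma_evidence \<alpha> \<beta> p q * inv_gamma_density (\<alpha> + p / 2) (\<beta> + q / 2) s"
proof (cases "s > 0")
  case True
  have G: "Gamma (\<alpha> + p / 2) \<noteq> 0" "Gamma \<alpha> \<noteq> 0"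
    using Gamma_real_pos[of \<alpha>] Gamma_real_pos[of "\<alpha> + p / 2"] assms
    by (simp_all del: Gamma_real_pos add: less_imp_neq[symmetric])
  have B: "(\<beta> + q / 2) powr (\<alpha> + p / 2) \<noteq> 0"
    using assms by (simp add: add_pos_nonneg)
  have e: "exp (- \<beta> / s) * exp (- q / (2 * s)) = exp (- (\<beta> + q / 2) / s)"
    using True by (simp add: exp_add[symmetric] field_simps)
  have t: "s powr (- (\<alpha> + 1)) * s powr (- p / 2) = s powr (- (\<alpha> + p / 2 + 1))"
  proof -
    have "- (\<alpha> + 1) + - p / 2 = - (\<alpha> + p / 2 + 1)" by simp
    then show ?thesis by (metis powr_add)
  qed
  have "inv_gamma_density \<alpha> \<beta> s * ((2 * pi * s) powr (- p / 2) * exp (- q / (2 * s))) =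
     \<beta> powr \<alpha> / Gamma \<alpha> * (2 * pi) powr (- p / 2) *
       (s powr (- (\<alpha> + 1)) * s powr (- p / 2)) * (exp (- \<beta> / s) * exp (- q / (2 * s)))"
    using True by (simp add: inv_gamma_density_def powr_mult)
  also have "\<dots> = \<beta> powr \<alpha> / (Gamma \<alpha> * (2 * pi) powr (p / 2)) *
       s powr (- (\<alpha> + p / 2 + 1)) * exp (- (\<beta> + q / 2) / s)"
    unfolding e t by (simp add: powr_minus_divide)
  also have "\<dots> = inv_gamma_evidence \<alpha> \<beta> p q * inv_gamma_density (\<alpha> + p / 2) (\<beta> + q / 2) s"
    using G B True by (simp add: inv_gamma_evidence_def inv_gamma_density_def)
  finally show ?thesis .
qed (simp add: inv_gamma_density_def)

section \<open>Product measures and orthogonal invariance of Lebesgue measure\<close>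

text \<open>On a box the density factorises, so its integral is a product of integrals, and boxes
  determine a product of sigma-finite measures. Sigma-finiteness of the factors on the left is a
  separate assumption because a density may destroy it.\<close>

lemma PiM_density:
  fixes f :: "'i \<Rightarrow> 'a \<Rightarrow> ennreal"
  assumes "finite I"
    and M: "\<And>i. sigma_finite_measure (M i)"
    and D: "\<And>i. sigma_finite_measure (density (M i) (f i))"
    and f: "\<And>i. f i \<in> borel_measurable (M i)"
  shows "(\<Pi>\<^sub>M i\<in>I. density (M i) (f i)) = density (\<Pi>\<^sub>M i\<in>I. M i) (\<lambda>x. \<Prod>i\<in>I. f i (x i))"
proof (rule sym, rule product_sigma_finite.PiM_eqI)
  interpret M: product_sigma_finite M by (simp add: product_sigma_finite_def M)
  note [measurable] = f
  show "product_sigma_finite (\<lambda>i. density (M i) (f i))"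
    by (simp add: product_sigma_finite_def D)
  show "finite I" by fact
  show "sets (density (Pi\<^sub>M I M) (\<lambda>x. \<Prod>i\<in>I. f i (x i))) = sets (\<Pi>\<^sub>M i\<in>I. density (M i) (f i))"
    by (simp cong: sets_PiM_cong)
  fix A assume "\<And>i. i \<in> I \<Longrightarrow> A i \<in> sets (density (M i) (f i))"
  then have A[measurable]: "\<And>i. i \<in> I \<Longrightarrow> A i \<in> sets (M i)" by simp
  have [measurable]: "Pi\<^sub>E I A \<in> sets (Pi\<^sub>M I M)"
    using \<open>finite I\<close> A by (rule sets_PiM_I_finite)
  have "emeasure (density (Pi\<^sub>M I M) (\<lambda>x. \<Prod>i\<in>I. f i (x i))) (Pi\<^sub>E I A) =
     (\<integral>\<^sup>+ x. (\<Prod>i\<in>I. f i (x i)) * indicator (Pi\<^sub>E I A) x \<partial>Pi\<^sub>M I M)"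
    by (subst emeasure_density) auto
  also have "\<dots> = (\<integral>\<^sup>+ x. (\<Prod>i\<in>I. f i (x i) * indicator (A i) (x i)) \<partial>Pi\<^sub>M I M)"
  proof (rule nn_integral_cong)
    fix x assume "x \<in> space (Pi\<^sub>M I M)"
    then have "indicator (Pi\<^sub>E I A) x = (\<Prod>i\<in>I. indicator (A i) (x i) :: ennreal)"
      using \<open>finite I\<close> by (auto simp: indicator_def space_PiM PiE_iff prod_zero_iff)
    then show "(\<Prod>i\<in>I. f i (x i)) * indicator (Pi\<^sub>E I A) x = (\<Prod>i\<in>I. f i (x i) * indicator (A i) (x i))"
      by (simp add: prod.distrib)
  qed
  also have "\<dots> = (\<Prod>i\<in>I. \<integral>\<^sup>+ x. f i x * indicator (A i) x \<partial>M i)"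
    by (rule M.product_nn_integral_prod) (use \<open>finite I\<close> A in \<open>auto\<close>)
  also have "\<dots> = (\<Prod>i\<in>I. emeasure (density (M i) (f i)) (A i))"
    by (intro prod.cong) (auto simp: emeasure_density)
  finally show "emeasure (density (Pi\<^sub>M I M) (\<lambda>x. \<Prod>i\<in>I. f i (x i))) (Pi\<^sub>E I A) =
     (\<Prod>i\<in>I. emeasure (density (M i) (f i)) (A i))" .
qed

text \<open>A translation-invariant measure is determined up to a factor, by Fubini's theorem for
  \<open>indicator A x * indicator B (x + y)\<close>; taking the unit ball for \<open>B\<close> the factor is one.\<close>

lemma distr_lborel_orthogonal:
  fixes f :: "'a::euclidean_space \<Rightarrow> 'a"
  assumes f: "orthogonal_transformation f"
  shows "distr lborel borel f = lborel"
proof -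
  have lin: "linear f" using f by (rule orthogonal_transformation_linear)
  have [measurable]: "f \<in> borel_measurable borel"
    by (intro borel_measurable_continuous_onI linear_continuous_on)
       (use lin in \<open>simp add: linear_conv_bounded_linear\<close>)
  define \<mu> where "\<mu> = distr lborel borel f"
  have [measurable_cong, simp]: "sets \<mu> = sets borel" by (simp add: \<mu>_def)
  have nn_mu: "(\<integral>\<^sup>+ x. h x \<partial>\<mu>) = (\<integral>\<^sup>+ x. h (f x) \<partial>lborel)" if [measurable]: "h \<in> borel_measurable borel" for h
    unfolding \<mu>_def by (subst nn_integral_distr) auto
  have trans: "(\<integral>\<^sup>+ x. h (x + c) \<partial>\<mu>) = (\<integral>\<^sup>+ x. h x \<partial>\<mu>)" if [measurable]: "h \<in> borel_measurable borel" for h c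
  proof -
    obtain d where d: "c = f d"
      using orthogonal_transformation_surj[OF f] by (meson surjD)
    have "(\<integral>\<^sup>+ x. h (x + c) \<partial>\<mu>) = (\<integral>\<^sup>+ x. h (f (x + d)) \<partial>lborel)"
      by (simp add: nn_mu d linear_add[OF lin])
    also have "\<dots> = (\<integral>\<^sup>+ x. h (f x) \<partial>distr lborel borel ((+) d))"
      by (subst nn_integral_distr) (auto simp: add.commute)
    also have "\<dots> = (\<integral>\<^sup>+ x. h x \<partial>\<mu>)"
      by (simp add: nn_mu lborel_distr_plus)
    finally show ?thesis .
  qed
  have trans_l: "(\<integral>\<^sup>+ x. h (x + c) \<partial>lborel) = (\<integral>\<^sup>+ x. h x \<partial>lborel)"
    if [measurable]: "h \<in> borel_measurable borel" for h and c :: 'a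
  proof -
    have "(\<integral>\<^sup>+ x. h (x + c) \<partial>lborel) = (\<integral>\<^sup>+ x. h x \<partial>distr lborel borel ((+) c))"
      by (subst nn_integral_distr) (auto simp: add.commute)
    then show ?thesis by (simp add: lborel_distr_plus)
  qed
  have refl_l: "(\<integral>\<^sup>+ x. h (- x) \<partial>lborel) = (\<integral>\<^sup>+ x. h x \<partial>lborel)"
    if [measurable]: "h \<in> borel_measurable borel" for h :: "'a \<Rightarrow> ennreal"
  proof -
    have "lborel = distr lborel borel (uminus :: 'a \<Rightarrow> 'a)"
      using lborel_affine[of "-1" "0 :: 'a"] by (simp add: density_1)
    then have "(\<integral>\<^sup>+ x. h x \<partial>lborel) = (\<integral>\<^sup>+ x. h x \<partial>distr lborel borel uminus)"
      by (rule arg_cong[where f = "\<lambda>M. integral\<^sup>N M h"])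
    then show ?thesis
      by (simp add: nn_integral_distr)
  qed
  have inj: "inj f" using orthogonal_transformation_inj[OF f] .
  have "f -` ball 0 r = ball 0 r" for r
    using orthogonal_transformation_norm[OF f] by auto
  then have ball: "emeasure \<mu> (ball 0 r) = emeasure lborel (ball 0 r :: 'a set)" for r
    unfolding \<mu>_def by (subst emeasure_distr) auto
  have fin_ball: "emeasure lborel (ball 0 r :: 'a set) < \<infinity>" for r
    by (intro emeasure_bounded_finite) auto
  have pos_ball: "emeasure lborel (ball 0 1 :: 'a set) \<noteq> 0"
    using open_not_negligible[of "ball 0 1 :: 'a set"]
    by (auto simp: negligible_iff_null_sets null_sets_def)
  interpret mu: sigma_finite_measure \<mu>
  proof
    show "\<exists>A. countable A \<and> A \<subseteq> sets \<mu> \<and> \<Union> A = space \<mu> \<and> (\<forall>a\<in>A. emeasure \<mu> a \<noteq> \<infinity>)"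
    proof (intro exI conjI)
      show "\<Union> (range (\<lambda>n::nat. ball 0 (real n))) = space \<mu>"
        by (auto simp: \<mu>_def) (meson reals_Archimedean2)
    qed (use fin_ball in \<open>auto simp: ball less_top\<close>)
  qed
  interpret pair_sigma_finite \<mu> lborel ..
  have eq: "emeasure \<mu> A = emeasure lborel A" if [measurable]: "A \<in> sets borel" for A
  proof -
    define B where "B = (ball 0 1 :: 'a set)"
    have [measurable]: "B \<in> sets borel" by (simp add: B_def)
    have "emeasure \<mu> A * emeasure lborel B = 
        (\<integral>\<^sup>+ x. \<integral>\<^sup>+ y. indicator A x * indicator B y \<partial>lborel \<partial>\<mu>)"
      by (simp add: nn_integral_cmult nn_integral_multc)
    \<comment> \<open>This shift in \<open>y\<close> uses the invariance of Lebesgue measure; after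
      the exchange of integrals, the shift in \<open>x\<close> uses that of \<open>\<mu>\<close>.
      Together they let \<open>A\<close> and \<open>B\<close> trade measures.\<close>
    also have "\<dots> = (\<integral>\<^sup>+ x. \<integral>\<^sup>+ y. indicator A x * indicator B (y + x) \<partial>lborel \<partial>\<mu>)"
      by (intro nn_integral_cong trans_l[symmetric]) auto
    also have "\<dots> = (\<integral>\<^sup>+ y. \<integral>\<^sup>+ x. indicator A x * indicator B (y + x) \<partial>\<mu> \<partial>lborel)"
      by (rule Fubini'[symmetric]) measurable
    also have "\<dots> = (\<integral>\<^sup>+ y. \<integral>\<^sup>+ x. indicator A (x - y) * indicator B x \<partial>\<mu> \<partial>lborel)"
    proof (rule nn_integral_cong)
      fix y :: 'a
      show "(\<integral>\<^sup>+ x. indicator A x * indicator B (y + x) \<partial>\<mu>) = (\<integral>\<^sup>+ x. indicator A (x - y) * indicator B x \<partial>\<mu>)"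
        using trans[of "\<lambda>x. indicator A (x - y) * indicator B x" y] by (simp add: add.commute)
    qed
    also have "\<dots> = (\<integral>\<^sup>+ x. \<integral>\<^sup>+ y. indicator A (x - y) * indicator B x \<partial>lborel \<partial>\<mu>)"
      by (rule Fubini') measurable
    also have "\<dots> = (\<integral>\<^sup>+ x. emeasure lborel A * indicator B x \<partial>\<mu>)"
    proof (rule nn_integral_cong)
      fix x :: 'a
      have "(\<integral>\<^sup>+ y. indicator A (x - y) \<partial>lborel) = (\<integral>\<^sup>+ y. indicator A (y + x) \<partial>lborel)"
        using refl_l[of "\<lambda>y. indicator A (x - y)"] by (simp add: add.commute)
      also have "\<dots> = emeasure lborel A"
        by (subst trans_l) auto
      finally show "(\<integral>\<^sup>+ y. indicator A (x - y) * indicator B x \<partial>lborel) = emeasure lborel A * indicator B x"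
        by (subst nn_integral_multc) auto
    qed
    also have "\<dots> = emeasure lborel A * emeasure lborel B"
      by (subst nn_integral_cmult_indicator) (auto simp: ball B_def)
    finally show ?thesis
      using pos_ball fin_ball[of 1]
      by (metis B_def ennreal_mult_divide_eq infinity_ennreal_def less_irrefl)
  qed
  show ?thesis
    by (rule measure_eqI) (use eq in \<open>simp_all add: \<mu>_def\<close>)
qed

section \<open>Orthogonal projections in matrix form\<close>

lemma in_span_indexed:
  assumes "inj_on y {..<l::nat}" "x \<in> span (y ` {..<l})"
  obtains c where "x = (\<Sum>k<l. c k *\<^sub>R y k)"
proof -
  obtain u where "x = (\<Sum>v\<in>y ` {..<l}. u v *\<^sub>R v)"
    using assms(2) by (auto simp: span_finite)
  then have "x = (\<Sum>k<l. u (y k) *\<^sub>R y k)"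
    by (simp add: sum.reindex[OF assms(1)])
  then show thesis by (rule that)
qed

text \<open>Subtracting from \<open>y i\<close> its projection onto the span of the other vectors
  leaves a residual \<open>z\<close> orthogonal to them. Independence makes \<open>z\<close>
  nonzero, and \<open>z \<bullet> y i = z \<bullet> z\<close> shows how to normalise it.\<close>

lemma dual_basis_exists:
  fixes y :: "nat \<Rightarrow> 'a::euclidean_space"
  assumes inj: "inj_on y {..<l}" and ind: "independent (y ` {..<l})"
  obtains w where "\<And>i. i < l \<Longrightarrow> w i \<in> span (y ` {..<l})"
    "\<And>i j. i < l \<Longrightarrow> j < l \<Longrightarrow> w i \<bullet> y j = (if i = j then 1 else 0)"
proof -
  have "\<exists>w. w \<in> span (y ` {..<l}) \<and> (\<forall>j<l. w \<bullet> y j = (if i = j then 1 else 0))" if i: "i < l" for i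
  proof -
    define S where "S = y ` ({..<l} - {i})"
    obtain a z where az: "a \<in> span S" "\<And>w. w \<in> span S \<Longrightarrow> orthogonal z w" "y i = a + z"
      using orthogonal_subspace_decomp_exists[of S "y i"] by metis
    have "S = y ` {..<l} - {y i}"
      using inj i unfolding S_def by (auto simp: inj_on_def)
    then have "y i \<notin> span S"
      using ind i unfolding dependent_def by auto
    then have z0: "z \<noteq> 0" using az by auto
    have zy: "z \<bullet> y j = (if i = j then z \<bullet> z else 0)" if "j < l" for j
    proof (cases "i = j")
      case True
      then show ?thesis using az(2)[OF az(1)] az(3)
        by (simp add: orthogonal_def inner_add_right)
    next
      case False
      then have "y j \<in> span S" using that by (intro span_base) (auto simp: S_def)
      then show ?thesis using az(2) False by (auto simp: orthogonal_def)
    qed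
    have "span S \<subseteq> span (y ` {..<l})" by (intro span_mono) (auto simp: S_def)
    then have "a \<in> span (y ` {..<l})" using az(1) by auto
    then have "z \<in> span (y ` {..<l})"
      using az(3) i by (metis add_diff_cancel_left' imageI lessThan_iff span_base span_diff)
    then show ?thesis
      using zy z0 by (intro exI[of _ "inverse (z \<bullet> z) *\<^sub>R z"]) (auto intro: span_mul)
  qed
  then show thesis using that by metis
qed

text \<open>The Gram matrix of \<open>y\<close> is inverted by the Gram matrix of the dual basis:
  the coefficients of \<open>w i\<close> in terms of the \<open>y k\<close> are
  \<open>w i \<bullet> w k\<close>, and pairing this expansion with \<open>y j\<close> gives the
  identity. This supplies the witness for the \<open>SOME\<close> in
  \<open>fun_matrix_inv\<close>.\<close>

lemma fun_matrix_inv_gram: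
  fixes y :: "nat \<Rightarrow> 'a::euclidean_space"
  assumes inj: "inj_on y {..<l}" and ind: "independent (y ` {..<l})"
    and "i < l" "j < l"
  shows "(\<Sum>k<l. fun_matrix_inv l (\<lambda>p q. y p \<bullet> y q) i k * (y k \<bullet> y j)) = (if i = j then 1 else 0)"
proof -
  obtain w where w: "\<And>i. i < l \<Longrightarrow> w i \<in> span (y ` {..<l})"
    "\<And>i j. i < l \<Longrightarrow> j < l \<Longrightarrow> w i \<bullet> y j = (if i = j then 1 else 0)"
    using dual_basis_exists[OF inj ind] by metis
  have expand: "(\<Sum>k<l. (w i \<bullet> w k) *\<^sub>R y k) = w i" if i: "i < l" for i
  proof -
    obtain c where c: "w i = (\<Sum>k<l. c k *\<^sub>R y k)"
      using in_span_indexed[OF inj w(1)[OF i]] .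
    have "w i \<bullet> w k = c k" if k: "k < l" for k
    proof -
      have "w i \<bullet> w k = (\<Sum>q<l. c q * (w k \<bullet> y q))"
        by (subst inner_commute, subst c) (simp add: inner_sum_right)
      also have "\<dots> = (\<Sum>q<l. if k = q then c q else 0)"
        using w(2) k by (intro sum.cong) auto
      finally show ?thesis using k by simp
    qed
    then show ?thesis by (subst c) simp
  qed
  have left: "(\<Sum>k<l. (w i \<bullet> w k) * (y k \<bullet> y j)) = (if i = j then 1 else 0)" if "i < l" "j < l" for i j
  proof -
    have "(\<Sum>k<l. (w i \<bullet> w k) * (y k \<bullet> y j)) = (\<Sum>k<l. (w i \<bullet> w k) *\<^sub>R y k) \<bullet> y j"
      by (simp add: inner_sum_left)
    then show ?thesis using that by (simp add: expand w)
  qed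
  have right: "(\<Sum>k<l. (y i \<bullet> y k) * (w k \<bullet> w j)) = (if i = j then 1 else 0)" if "i < l" "j < l" for i j
    using left[OF that(2,1)] by (simp add: mult.commute inner_commute)
  have "\<exists>H. \<forall>i<l. \<forall>j<l. (\<Sum>k<l. (y i \<bullet> y k) * H k j) = (if i = j then 1 else 0) \<and>
     (\<Sum>k<l. H i k * (y k \<bullet> y j)) = (if i = j then 1 else 0)"
    by (rule exI[of _ "\<lambda>i j. w i \<bullet> w j"]) (use left right in auto)
  from someI_ex[OF this] show ?thesis
    unfolding fun_matrix_inv_def using assms by blast
qed

lemma column_projection_apply:
  "column_projection l y *v v =
     (\<Sum>i<l. (\<Sum>j<l. fun_matrix_inv l (\<lambda>p q. y p \<bullet> y q) i j * (y j \<bullet> v)) *\<^sub>R y i)"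
  unfolding vec_eq_iff column_projection_def matrix_vector_mult_def
  by (auto simp: inner_vec_def sum_distrib_left sum_distrib_right sum.swap[of _ UNIV] mult_ac
      intro!: sum.cong)

lemma column_projection_orthogonal:
  assumes "\<And>j. j < l \<Longrightarrow> y j \<bullet> v = 0"
  shows "column_projection l y *v v = 0"
  using assms by (simp add: column_projection_apply)

lemma column_projection_in_span:
  assumes inj: "inj_on y {..<l}" and ind: "independent (y ` {..<l})"
    and v: "v \<in> span (y ` {..<l})"
  shows "column_projection l y *v v = v"
proof -
  let ?H = "fun_matrix_inv l (\<lambda>p q. y p \<bullet> y q)"
  obtain c where c: "v = (\<Sum>k<l. c k *\<^sub>R y k)"
    using in_span_indexed[OF inj v] .
  have "(\<Sum>j<l. ?H i j * (y j \<bullet> v)) = c i" if i: "i < l" for i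
  proof -
    have "(\<Sum>j<l. ?H i j * (y j \<bullet> v)) = (\<Sum>j<l. \<Sum>k<l. c k * (?H i j * (y j \<bullet> y k)))"
      by (subst c) (simp add: inner_sum_right sum_distrib_left mult_ac)
    also have "\<dots> = (\<Sum>k<l. c k * (\<Sum>j<l. ?H i j * (y j \<bullet> y k)))"
      by (subst sum.swap) (simp add: sum_distrib_left)
    also have "\<dots> = (\<Sum>k<l. if i = k then c k else 0)"
      using i by (intro sum.cong) (auto simp: fun_matrix_inv_gram[OF inj ind])
    finally show ?thesis using i by simp
  qed
  then show ?thesis
    unfolding column_projection_apply by (subst (2) c) simp
qed

section \<open>Orthonormal sets and the projections onto their spans\<close>

definition orthonormal :: "'a::real_inner set \<Rightarrow> bool" where
  "orthonormal E \<longleftrightarrow> pairwise orthogonal E \<and> (\<forall>u\<in>E. norm u = 1)"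

lemma orthonormal_finite:
  fixes E :: "'a::euclidean_space set"
  shows "orthonormal E \<Longrightarrow> finite E"
  by (auto simp: orthonormal_def intro: pairwise_orthogonal_imp_finite)

lemma orthonormal_inner: 
  "orthonormal E \<Longrightarrow> u \<in> E \<Longrightarrow> v \<in> E \<Longrightarrow> u \<bullet> v = (if u = v then 1 else 0)"
  by (auto simp: orthonormal_def pairwise_def orthogonal_def norm_eq_1)

lemma orthonormal_independent:
  fixes E :: "'a::euclidean_space set"
  shows "orthonormal E \<Longrightarrow> independent E"
  by (rule pairwise_orthogonal_independent) (auto simp: orthonormal_def)

lemma orthonormal_inner_sum:
  fixes E :: "'a::euclidean_space set"
  assumes E: "orthonormal E" and u: "u \<in> E"
  shows "u \<bullet> (\<Sum>v\<in>E. c v *\<^sub>R v) = c u"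
proof -
  have "u \<bullet> (\<Sum>v\<in>E. c v *\<^sub>R v) = (\<Sum>v\<in>E. if u = v then c v else 0)"
    unfolding inner_sum_right by (intro sum.cong) (auto simp: orthonormal_inner[OF E u])
  then show ?thesis using u orthonormal_finite[OF E] by simp
qed

lemma orthonormal_norm_sum:
  fixes E :: "'a::euclidean_space set"
  assumes E: "orthonormal E"
  shows "(norm (\<Sum>v\<in>E. c v *\<^sub>R v))\<^sup>2 = (\<Sum>v\<in>E. (c v)\<^sup>2)"
  unfolding power2_norm_eq_inner inner_sum_left
  by (intro sum.cong) (auto simp: orthonormal_inner_sum[OF E] power2_eq_square)

lemma orthonormal_expand:
  fixes E :: "'a::euclidean_space set"
  assumes E: "orthonormal E" and v: "v \<in> span E"
  shows "(\<Sum>u\<in>E. (u \<bullet> v) *\<^sub>R u) = v"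
proof -
  obtain c where c: "v = (\<Sum>u\<in>E. c u *\<^sub>R u)"
    using v by (auto simp: span_finite[OF orthonormal_finite[OF E]])
  show ?thesis
    by (subst (2) c, intro sum.cong) (auto simp: c orthonormal_inner_sum[OF E])
qed

text \<open>A relation, since many orthonormal sets \<open>E\<close> belong to one matrix
  \<open>P\<close>, and the set chosen inside \<open>student\<close> need not be the one at hand. An
  empty \<open>E\<close> is allowed and corresponds to \<open>l = 0\<close>.\<close>

definition is_projection :: "real ^ 'n ^ 'n \<Rightarrow> (real ^ 'n) set \<Rightarrow> bool" where
  "is_projection P E \<longleftrightarrow> orthonormal E \<and> (\<forall>v. P *v v = (\<Sum>u\<in>E. (u \<bullet> v) *\<^sub>R u))"

text \<open>Split \<open>v = a + z\<close> with \<open>a\<close> in the span and \<open>z\<close>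
  orthogonal to it. The matrix formula fixes \<open>a\<close> and kills \<open>z\<close>, and so
  does the expansion in \<open>E\<close>.\<close>

lemma is_projection_column_projection:
  assumes inj: "inj_on y {..<l}" and ind: "independent (y ` {..<l})"
    and E: "orthonormal E" and span: "span E = span (y ` {..<l})"
  shows "is_projection (column_projection l y) E"
  unfolding is_projection_def
proof (intro conjI allI E)
  fix v
  obtain a z where az: "a \<in> span E" "\<And>w. w \<in> span E \<Longrightarrow> orthogonal z w" "v = a + z"
    using orthogonal_subspace_decomp_exists[of E v] by metis
  have "y j \<bullet> z = 0" if "j < l" for j
    using az(2)[of "y j"] that unfolding span by (auto simp: span_base orthogonal_def inner_commute)
  then have "column_projection l y *v v = a"
    using az by (simp add: matrix_vector_right_distrib column_projection_orthogonal
        column_projection_in_span[OF inj ind] span)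
  also have "a = (\<Sum>u\<in>E. (u \<bullet> a) *\<^sub>R u)"
    using orthonormal_expand[OF E az(1)] by simp
  also have "\<dots> = (\<Sum>u\<in>E. (u \<bullet> v) *\<^sub>R u)"
    using az by (intro sum.cong) (auto simp: inner_add_right span_base orthogonal_def inner_commute)
  finally show "column_projection l y *v v = (\<Sum>u\<in>E. (u \<bullet> v) *\<^sub>R u)" .
qed

lemma is_projection_fixes: "is_projection P E \<Longrightarrow> v \<in> span E \<Longrightarrow> P *v v = v"
  by (simp add: is_projection_def orthonormal_expand)

lemma is_projection_in_span: "is_projection P E \<Longrightarrow> P *v v \<in> span E"
  unfolding is_projection_def by (auto intro: span_sum[OF span_mul[OF span_base]])

lemma is_projection_range: "is_projection P E \<Longrightarrow> range ((*v) P) = span E"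
  by (metis is_projection_fixes is_projection_in_span rangeI subsetI subset_antisym image_subsetI)

lemma is_projection_idem: "is_projection P E \<Longrightarrow> P ** P = P"
  unfolding matrix_eq
  by (simp add: is_projection_fixes is_projection_in_span flip: matrix_vector_mul_assoc)

lemma matrix_of_outer_products:
  fixes E :: "(real ^ 'n) set"
  shows "(\<chi> i j. \<Sum>u\<in>E. u $ i * d u * u $ j) *v v = (\<Sum>u\<in>E. (d u * (u \<bullet> v)) *\<^sub>R u)"
  unfolding vec_eq_iff matrix_vector_mult_def
  by (auto simp: inner_vec_def sum_distrib_left sum_distrib_right sum.swap[of _ UNIV] mult_ac
      intro!: sum.cong)

lemma is_projection_entries:
  assumes "is_projection P E"
  shows "P = (\<chi> i j. \<Sum>u\<in>E. u $ i * u $ j)"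
  using matrix_of_outer_products[where E = E and d = "\<lambda>_. 1"] assms by (simp add: matrix_eq is_projection_def)

lemma is_projection_symmetric: "is_projection P E \<Longrightarrow> transpose P = P"
  by (drule is_projection_entries) (auto simp: transpose_def vec_eq_iff mult.commute)

section \<open>Rank, pseudoinverse and spectral decompositions of a multiple of a projection\<close>

lemma rank_scaled_projection:
  assumes P: "is_projection P E" and c: "c \<noteq> 0"
  shows "rank (c *\<^sub>R P) = card E"
proof -
  have "range ((*v) (c *\<^sub>R P)) = (\<lambda>v. c *\<^sub>R v) ` span E"
    unfolding is_projection_range[OF P, symmetric] image_image
    by (simp add: scaleR_matrix_vector_assoc)
  also have "\<dots> = span E"
  proof safe
    fix v assume "v \<in> span E"
    then show "v \<in> (\<lambda>v. c *\<^sub>R v) ` span E"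
      using c by (intro image_eqI[of _ _ "inverse c *\<^sub>R v"]) (auto intro: span_mul)
  qed (auto intro: span_mul)
  finally show ?thesis
    using P by (simp add: rank_dim_range is_projection_def dim_eq_card_independent orthonormal_independent)
qed

text \<open>For uniqueness, the first Penrose equation gives
  \<open>P ** G ** P = (1 / c) *\<^sub>R P\<close>. Symmetry rewrites \<open>G ** P\<close> as
  \<open>P ** transpose G\<close>, so multiplying it by \<open>P\<close> on the left changes nothing
  and \<open>G ** P\<close> is itself \<open>(1 / c) *\<^sub>R P\<close>; likewise
  \<open>P ** G\<close>. The second Penrose equation rebuilds \<open>G\<close> from these two
  products.\<close>

lemma pinv_scaled_projection:
  assumes P: "is_projection P E" and c: "c \<noteq> 0"
  shows "pinv (c *\<^sub>R P) = (1 / c) *\<^sub>R P"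
  unfolding pinv_def
proof (rule the_equality)
  note PP = is_projection_idem[OF P] is_projection_symmetric[OF P]
  have sm: "(a *\<^sub>R A) ** B = a *\<^sub>R (A ** B)" "A ** (a *\<^sub>R B) = a *\<^sub>R (A ** B)"
    for a and A B :: "real ^ 'n ^ 'n"
    by (simp_all add: matrix_scalar_ac scalar_matrix_assoc flip: scalar_mult_eq_scaleR)
  have ts: "transpose (a *\<^sub>R A) = a *\<^sub>R transpose A" for a and A :: "real ^ 'n ^ 'n"
    by (simp add: transpose_def vec_eq_iff)
  show "c *\<^sub>R P ** ((1 / c) *\<^sub>R P) ** c *\<^sub>R P = c *\<^sub>R P \<and>
    (1 / c) *\<^sub>R P ** c *\<^sub>R P ** ((1 / c) *\<^sub>R P) = (1 / c) *\<^sub>R P \<and>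
    transpose (c *\<^sub>R P ** ((1 / c) *\<^sub>R P)) = c *\<^sub>R P ** ((1 / c) *\<^sub>R P) \<and>
    transpose ((1 / c) *\<^sub>R P ** c *\<^sub>R P) = (1 / c) *\<^sub>R P ** c *\<^sub>R P"
    using c by (simp add: sm ts PP)
  fix G
  assume G: "c *\<^sub>R P ** G ** c *\<^sub>R P = c *\<^sub>R P \<and> G ** c *\<^sub>R P ** G = G \<and>
    transpose (c *\<^sub>R P ** G) = c *\<^sub>R P ** G \<and> transpose (G ** c *\<^sub>R P) = G ** c *\<^sub>R P"
  have PGP: "P ** G ** P = (1 / c) *\<^sub>R P"
  proof -
    have "c *\<^sub>R (c *\<^sub>R (P ** G ** P)) = c *\<^sub>R P" using G by (simp add: sm)
    then have "P ** G ** P = (1 / c) *\<^sub>R ((1 / c) *\<^sub>R (c *\<^sub>R P))"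
      using c by (metis (no_types, lifting) divide_inverse inverse_eq_divide mult_1 scaleR_left_imp_eq scaleR_one scaleR_scaleR right_inverse left_inverse)
    then show ?thesis using c by simp
  qed
  have "c *\<^sub>R transpose (G ** P) = c *\<^sub>R (G ** P)" "c *\<^sub>R transpose (P ** G) = c *\<^sub>R (P ** G)"
    using G by (auto simp: sm ts)
  then have tr: "transpose (G ** P) = G ** P" "transpose (P ** G) = P ** G" using c by auto
  have GP': "G ** P = P ** transpose G" and PG': "P ** G = transpose G ** P"
    using tr by (simp_all add: matrix_transpose_mul PP)
  have "G ** P = P ** (G ** P)"
    unfolding GP' by (simp add: matrix_mul_assoc PP)
  then have GP: "G ** P = (1 / c) *\<^sub>R P" using PGP by (simp add: matrix_mul_assoc)
  have "P ** G = (P ** G) ** P"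
    unfolding PG' by (simp add: PP flip: matrix_mul_assoc)
  then have PG: "P ** G = (1 / c) *\<^sub>R P" using PGP by simp
  have "G = c *\<^sub>R (G ** P ** G)" using G by (simp add: sm)
  also have "G ** P ** G = (G ** P) ** (P ** G)"
    by (metis PP(1) matrix_mul_assoc)
  finally show "G = (1 / c) *\<^sub>R P"
    using c by (simp add: GP PG sm PP)
qed

lemma spectral_decomposition_scaled_projection:
  assumes "is_projection P E" "c > 0"
  shows "spectral_decomposition (c *\<^sub>R P) E (\<lambda>_. c)"
  using assms unfolding spectral_decomposition_def is_projection_entries[OF assms(1)]
  by (auto simp: is_projection_def orthonormal_def vec_eq_iff sum_distrib_left mult_ac)

text \<open>Each \<open>u\<close> in \<open>E\<close> is an eigenvector for the eigenvalue
  \<open>d u\<close>. As \<open>d u\<close> is not zero, \<open>u\<close> lies in the range of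
  \<open>P\<close>, where \<open>c *\<^sub>R P\<close> acts as multiplication by \<open>c\<close>.
  Everything about a decomposition is thus forced except the choice of basis.\<close>

lemma spectral_decomposition_scaled_projectionD:
  assumes P: "is_projection P E0" and c: "c > 0" and S: "spectral_decomposition (c *\<^sub>R P) E d"
  shows "is_projection P E" and "span E = span E0" and "u \<in> E \<Longrightarrow> d u = c"
proof -
  have E: "orthonormal E" using S by (auto simp: spectral_decomposition_def orthonormal_def)
  have dpos: "d u > 0" if "u \<in> E" for u using S that by (auto simp: spectral_decomposition_def)
  have app: "c *\<^sub>R (P *v v) = (\<Sum>u\<in>E. (d u * (u \<bullet> v)) *\<^sub>R u)" for v
    using S matrix_of_outer_products[where E = E and d = d and v = v] by (simp add: spectral_decomposition_def scaleR_matrix_vector_assoc)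
  have Pu: "P *v u = u \<and> d u = c" if u: "u \<in> E" for u
  proof -
    have "c *\<^sub>R (P *v u) = (\<Sum>v\<in>E. if v = u then d u *\<^sub>R u else 0)"
      unfolding app by (intro sum.cong) (auto simp: orthonormal_inner[OF E _ u])
    also have "\<dots> = d u *\<^sub>R u" using u orthonormal_finite[OF E] by simp
    finally have "(1 / c) *\<^sub>R (c *\<^sub>R (P *v u)) = (1 / c) *\<^sub>R (d u *\<^sub>R u)" by simp
    then have 1: "P *v u = (d u / c) *\<^sub>R u" using c by simp
    have "u = (c / d u) *\<^sub>R (P *v u)" using 1 c dpos[OF u] by simp
    then have "u \<in> span E0" using is_projection_in_span[OF P] by (metis span_mul)
    then have 2: "P *v u = u" by (rule is_projection_fixes[OF P])
    have "u \<noteq> 0" using E u by (auto simp: orthonormal_def)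
    then have "d u / c = 1" using 1 2 by (metis scaleR_cancel_right scaleR_one)
    then show ?thesis using 2 c by auto
  qed
  then show "u \<in> E \<Longrightarrow> d u = c" by auto
  have "c *\<^sub>R (P *v v) = c *\<^sub>R (\<Sum>u\<in>E. (u \<bullet> v) *\<^sub>R u)" for v
    unfolding app scaleR_sum_right by (intro sum.cong) (auto simp: Pu)
  then show PE: "is_projection P E" using E c by (simp add: is_projection_def)
  show "span E = span E0" using is_projection_range[OF P] is_projection_range[OF PE] by simp
qed

text \<open>The basis comes out of a \<open>SOME\<close>, so it can only be obtained together with
  its span; \<open>subspace_lebesgue_basis\<close> later removes the dependence on it. The
  determinant is \<open>c ^ card E\<close>, and the pseudoinverse divides the quadratic form by
  \<open>c\<close>.\<close>

lemma student_scaled_projection: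
  assumes P: "is_projection P E0" and c: "c > 0"
  obtains E where "is_projection P E" "span E = span E0"
    "student \<nu> \<mu> (c *\<^sub>R P) = density (distr (\<Pi>\<^sub>M u\<in>E. lborel) borel (\<lambda>y. \<mu> + (\<Sum>u\<in>E. y u *\<^sub>R u)))
       (\<lambda>x. ennreal (Gamma ((\<nu> + card E) / 2) / (Gamma (\<nu> / 2) * sqrt ((pi * \<nu> * c) ^ card E))
         * (1 + 1 / \<nu> * ((x - \<mu>) \<bullet> (P *v (x - \<mu>)) / c)) powr (- (\<nu> + card E) / 2)))"
proof -
  define Ed where "Ed = (SOME (E, d). spectral_decomposition (c *\<^sub>R P) E d)"
  have "\<exists>Ed. (case Ed of (E, d) \<Rightarrow> spectral_decomposition (c *\<^sub>R P) E d)"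
    using spectral_decomposition_scaled_projection[OF P c] by auto
  from someI_ex[OF this] have "case Ed of (E, d) \<Rightarrow> spectral_decomposition (c *\<^sub>R P) E d"
    unfolding Ed_def .
  then obtain E d where Ed: "Ed = (E, d)" and S: "spectral_decomposition (c *\<^sub>R P) E d"
    by (cases Ed) auto
  note D = spectral_decomposition_scaled_projectionD[OF P c S]
  have r: "rank (c *\<^sub>R P) = card E" using rank_scaled_projection[OF D(1)] c by simp
  have "(\<Prod>u\<in>E. d u) = c ^ card E" using D(3) by simp
  then show thesis
    using that[OF D(1,2)] c Ed unfolding student_def Ed_def[symmetric] r Let_def
    by (simp add: pinv_scaled_projection[OF P] power_mult_distrib mult_ac flip: scaleR_matrix_vector_assoc)
qed

section \<open>Gaussian measures\<close>

abbreviation normal_measure :: "real \<Rightarrow> real measure" where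
  "normal_measure \<tau> \<equiv> density lborel (\<lambda>x. ennreal (normal_density 0 \<tau> x))"

lemma borel_measurable_vec_lambda [measurable]:
  assumes "\<And>i. (\<lambda>x. f x i) \<in> borel_measurable M"
  shows "(\<lambda>x. (\<chi> i. f x i) :: 'b::euclidean_space ^ 'n) \<in> borel_measurable M"
proof (subst borel_measurable_euclidean_space, intro ballI)
  fix b :: "'b ^ 'n" assume "b \<in> Basis"
  then obtain i c where "b = axis i c" by (auto simp: Basis_vec_def)
  then show "(\<lambda>x. (\<chi> i. f x i) \<bullet> b) \<in> borel_measurable M"
    using assms by (simp add: inner_axis)
qed

lemma borel_measurable_vec_nth [measurable (raw)]:
  fixes f :: "'a \<Rightarrow> 'b::euclidean_space ^ 'n"
  assumes "f \<in> borel_measurable M"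
  shows "(\<lambda>x. f x $ i) \<in> borel_measurable M"
  by (rule measurable_compose[OF assms])
     (intro borel_measurable_continuous_onI continuous_intros)

lemma borel_measurable_matrix_vector_mult [measurable (raw)]:
  fixes A :: "real ^ 'n ^ 'm"
  assumes "f \<in> borel_measurable M"
  shows "(\<lambda>x. A *v f x) \<in> borel_measurable M"
  by (rule measurable_compose[OF assms])
     (intro borel_measurable_continuous_onI continuous_intros)

lemma measurable_orthonormal_coordinates [measurable]:
  assumes "\<And>u. u \<in> E \<Longrightarrow> sets (M u) = sets borel"
  shows "(\<lambda>w. \<Sum>u\<in>E. w u *\<^sub>R (u :: 'a :: euclidean_space)) \<in> borel_measurable (Pi\<^sub>M E M)"
proof (intro borel_measurable_sum borel_measurable_scaleR)
  fix u assume "u \<in> E"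
  then have "(\<lambda>w. w u) \<in> measurable (Pi\<^sub>M E M) (M u)" by (rule measurable_component_singleton)
  then show "(\<lambda>w. w u) \<in> borel_measurable (Pi\<^sub>M E M)"
    using measurable_cong_sets[OF refl assms[OF \<open>u \<in> E\<close>]] by blast
qed simp_all

lemma prob_space_normal_measure: "\<tau> > 0 \<Longrightarrow> prob_space (normal_measure \<tau>)"
  by (rule prob_space_normal_density)

section \<open>Standard Gaussian vectors and their rotation invariance\<close>

lemma lborel_eq_distr_PiM:
  "distr (\<Pi>\<^sub>M i\<in>UNIV. lborel) borel vec_lambda = (lborel :: (real ^ 'n) measure)"
proof (rule lborel_eqI[symmetric])
  interpret product_sigma_finite "\<lambda>_::'n. lborel :: real measure"
    by (simp add: product_sigma_finite_def sigma_finite_lborel)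
  fix a b :: "real ^ 'n" assume le: "\<And>c. c \<in> Basis \<Longrightarrow> a \<bullet> c \<le> b \<bullet> c"
  have ab: "a $ i \<le> b $ i" for i
    using le[of "axis i 1"] by (auto simp: inner_axis Basis_vec_def)
  have Basis: "(Basis :: (real ^ 'n) set) = (\<lambda>i. axis i 1) ` UNIV"
    by (auto simp: Basis_vec_def)
  have inj: "inj (\<lambda>i. axis i 1 :: real ^ 'n)" by (auto simp: inj_def axis_eq_axis)
  have "vec_lambda -` box a b \<inter> space (\<Pi>\<^sub>M i\<in>(UNIV::'n set). (lborel :: real measure)) = (\<Pi>\<^sub>E i\<in>UNIV. {a $ i<..<b $ i})"
    by (auto simp: mem_box_cart space_PiM PiE_def Pi_def)
  then have "emeasure (distr (\<Pi>\<^sub>M i\<in>UNIV. lborel) borel vec_lambda) (box a b) =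
      emeasure (\<Pi>\<^sub>M i\<in>UNIV. lborel) (\<Pi>\<^sub>E i\<in>UNIV. {a $ i<..<b $ i})"
    by (subst emeasure_distr) auto
  also have "\<dots> = (\<Prod>i\<in>UNIV. ennreal (b $ i - a $ i))"
    using ab by (subst emeasure_PiM) auto
  also have "\<dots> = ennreal (\<Prod>i\<in>UNIV. b $ i - a $ i)"
    using ab by (intro prod_ennreal) auto
  also have "(\<Prod>i\<in>UNIV. b $ i - a $ i) = (\<Prod>c\<in>Basis. (b - a) \<bullet> c)"
    unfolding Basis by (subst prod.reindex[OF inj]) (simp add: inner_axis)
  finally show "emeasure (distr (\<Pi>\<^sub>M i\<in>UNIV. lborel) borel vec_lambda) (box a b) =
      (\<Prod>c\<in>Basis. (b - a) \<bullet> c)" .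
qed simp

lemma prod_normal_density:
  fixes x :: "'i \<Rightarrow> real"
  assumes "finite I" "\<tau> > 0"
  shows "(\<Prod>i\<in>I. normal_density 0 (sqrt \<tau>) (x i)) =
    (2 * pi * \<tau>) powr (- card I / 2) * exp (- (\<Sum>i\<in>I. (x i)\<^sup>2) / (2 * \<tau>))"
proof -
  have dens: "normal_density 0 (sqrt \<tau>) y = 1 / sqrt (2 * pi * \<tau>) * exp (- y\<^sup>2 / (2 * \<tau>))" for y
    using assms(2) by (simp add: normal_density_def)
  have "(2 * pi * \<tau>) powr (- card I / 2) = (1 / sqrt (2 * pi * \<tau>)) ^ card I"
  proof -
    have "1 / sqrt (2 * pi * \<tau>) = (2 * pi * \<tau>) powr (- (1 / 2))"
      using assms by (simp add: powr_half_sqrt powr_minus_divide)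
    then have "(1 / sqrt (2 * pi * \<tau>)) ^ card I = ((2 * pi * \<tau>) powr (- (1 / 2))) powr real (card I)"
      using assms by (simp add: powr_realpow)
    then show ?thesis by (simp add: powr_powr)
  qed
  moreover have "(\<Prod>i\<in>I. exp (- (x i)\<^sup>2 / (2 * \<tau>))) = exp (- (\<Sum>i\<in>I. (x i)\<^sup>2) / (2 * \<tau>))"
    by (simp add: exp_sum[OF assms(1), symmetric] sum_negf sum_divide_distrib)
  ultimately show ?thesis
    by (simp only: dens prod.distrib prod_constant)
qed

lemma std_gaussian_density:
  "std_gaussian = density lborel (\<lambda>z :: real ^ 'n. ennreal ((2 * pi) powr (- CARD('n) / 2) * exp (- (norm z)\<^sup>2 / 2)))"
proof -
  have "(\<Prod>i\<in>UNIV. std_normal_density (z $ i)) = (2 * pi) powr (- CARD('n) / 2) * exp (- (norm z)\<^sup>2 / 2)"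
    for z :: "real ^ 'n"
    using prod_normal_density[of UNIV 1 "\<lambda>i. z $ i"]
    by (simp add: power2_norm_eq_inner inner_vec_def flip: power2_eq_square)
  then show ?thesis unfolding std_gaussian_def by simp
qed

lemma space_std_gaussian [simp]: "space std_gaussian = UNIV"
  and sets_std_gaussian [simp, measurable_cong]: "sets std_gaussian = sets borel"
  by (simp_all add: std_gaussian_def)

lemma std_gaussian_eq_distr_PiM:
  "std_gaussian = distr (\<Pi>\<^sub>M i\<in>UNIV. normal_measure 1) borel (vec_lambda :: _ \<Rightarrow> real ^ 'n)"
proof -
  have "(\<Pi>\<^sub>M i\<in>(UNIV :: 'n set). normal_measure 1) =
      density (\<Pi>\<^sub>M i\<in>UNIV. lborel) (\<lambda>x. \<Prod>i\<in>UNIV. ennreal (std_normal_density (x i)))"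
    by (rule PiM_density)
       (auto intro: sigma_finite_lborel prob_space_imp_sigma_finite[OF prob_space_normal_measure])
  then have "distr (\<Pi>\<^sub>M i\<in>UNIV. normal_measure 1) borel (vec_lambda :: _ \<Rightarrow> real ^ 'n) =
     distr (density (\<Pi>\<^sub>M i\<in>UNIV. lborel) (\<lambda>x. ennreal (\<Prod>i\<in>UNIV. std_normal_density ((vec_lambda x :: real ^ 'n) $ i)))) borel vec_lambda"
    by (simp add: prod_ennreal)
  also have "\<dots> = std_gaussian"
    unfolding std_gaussian_def lborel_eq_distr_PiM[symmetric]
    by (rule density_distr[symmetric]) measurable
  finally show ?thesis by simp
qed

lemma prob_space_std_gaussian: "prob_space std_gaussian"
  unfolding std_gaussian_eq_distr_PiM
  by (intro prob_space.prob_space_distr prob_space_PiM prob_space_normal_measure) auto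

text \<open>The density depends on \<open>z\<close> through its norm only, and \<open>f\<close>
  preserves both the norm and Lebesgue measure.\<close>

lemma distr_std_gaussian_orthogonal:
  fixes f :: "real ^ 'n \<Rightarrow> real ^ 'n"
  assumes f: "orthogonal_transformation f"
  shows "distr std_gaussian borel f = std_gaussian"
proof -
  have [measurable]: "f \<in> borel_measurable borel"
    by (intro borel_measurable_continuous_onI linear_continuous_on)
       (use orthogonal_transformation_linear[OF f] in \<open>simp add: linear_conv_bounded_linear\<close>)
  let ?g = "\<lambda>z :: real ^ 'n. ennreal ((2 * pi) powr (- CARD('n) / 2) * exp (- (norm z)\<^sup>2 / 2))"
  have "distr (density lborel (\<lambda>z. ?g (f z))) borel f = density (distr lborel borel f) ?g"
    by (rule density_distr[symmetric]) measurable
  then show ?thesis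
    unfolding std_gaussian_density by (simp add: distr_lborel_orthogonal f orthogonal_transformation_norm[OF f])
qed

lemma matrix_inv_inverse:
  fixes B :: "'a::semiring_1 ^ 'n ^ 'n"
  assumes "invertible B"
  shows "B ** matrix_inv B = mat 1" and "matrix_inv B ** B = mat 1"
  using someI_ex[OF assms[unfolded invertible_def]] by (simp_all add: matrix_inv_def)

text \<open>For an invertible square root \<open>B\<close>, any other square root \<open>C\<close> of the same matrix is \<open>B\<close>
  times the orthogonal matrix \<open>B\<^sup>-\<^sup>1 C\<close>, so the choice made in the definition is immaterial.\<close>

lemma gaussian_eq_distr:
  fixes B :: "real ^ 'n ^ 'n"
  assumes "invertible B"
  shows "gaussian \<mu> (B ** transpose B) = distr std_gaussian borel (\<lambda>z. \<mu> + B *v z)"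
proof -
  define C :: "real ^ 'n ^ 'n" where "C = (SOME C. C ** transpose C = B ** transpose B)"
  have C: "C ** transpose C = B ** transpose B"
    unfolding C_def by (rule someI) simp
  define R where "R = matrix_inv B"
  have R: "R ** B = mat 1" "B ** R = mat 1"
    by (simp_all add: R_def matrix_inv_inverse[OF assms])
  define Q where "Q = R ** C"
  have "Q ** transpose Q = R ** (C ** transpose C) ** transpose R"
    by (simp add: Q_def matrix_transpose_mul matrix_mul_assoc)
  also have "\<dots> = (R ** B) ** transpose (R ** B)"
    by (simp add: C matrix_transpose_mul matrix_mul_assoc)
  finally have "Q ** transpose Q = mat 1" by (simp add: R transpose_mat)
  then have "orthogonal_matrix Q"
    by (simp add: orthogonal_matrix matrix_left_right_inverse)
  then have Q: "orthogonal_transformation ((*v) Q)"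
    by (simp add: orthogonal_transformation_matrix)
  have "C = B ** Q" by (simp add: Q_def matrix_mul_assoc R)
  then have "gaussian \<mu> (B ** transpose B) = distr std_gaussian borel (\<lambda>z. \<mu> + B *v (Q *v z))"
    by (simp add: gaussian_def Let_def C_def[symmetric] matrix_vector_mul_assoc)
  also have "\<dots> = distr (distr std_gaussian borel ((*v) Q)) borel (\<lambda>z. \<mu> + B *v z)"
    by (subst distr_distr) (auto simp: comp_def)
  finally show ?thesis by (simp add: distr_std_gaussian_orthogonal[OF Q])
qed

text \<open>The square root \<open>B\<close> used here has the columns of \<open>V\<close> and the vectors \<open>sqrt \<sigma> u\<close> as columns. It is
  injective because \<open>L\<close> kills the latter and \<open>L V\<close> is invertible.\<close>

lemma gaussian_prior_decomposition:
  fixes V :: "real ^ 'm ^ 'n" and L :: "real ^ 'n ^ 'm"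
  assumes P: "is_projection P E" and card: "card E + CARD('m) = CARD('n)"
    and LV: "invertible (L ** V)" and LE: "\<And>u. u \<in> E \<Longrightarrow> L *v u = 0" and \<sigma>: "\<sigma> > 0"
  shows "gaussian \<mu> (V ** transpose V + \<sigma> *\<^sub>R P) =
    distr ((\<Pi>\<^sub>M u\<in>E. normal_measure (sqrt \<sigma>)) \<Otimes>\<^sub>M std_gaussian) borel
      (\<lambda>(w, z). \<mu> + V *v z + (\<Sum>u\<in>E. w u *\<^sub>R u))"
proof -
  have E: "orthonormal E" using P by (simp add: is_projection_def)
  then have [simp]: "finite E" by (rule orthonormal_finite)
  \<comment> \<open>The coordinates of the ambient standard Gaussian are divided into a block
    \<open>I\<close>, indexing the columns of \<open>V\<close>, and a block \<open>J\<close>,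
    indexing \<open>E\<close>; by \<open>card\<close> the sizes fit. The enumerations
    \<open>h\<close> and \<open>k\<close> are arbitrary.\<close>
  obtain I :: "'n set" where I: "card I = CARD('m)"
    using obtain_subset_with_card_n[of "CARD('m)" "UNIV :: 'n set"] card by auto
  define J where "J = - I"
  have "card J = card E" using I card by (simp add: J_def Compl_eq_Diff_UNIV card_Diff_subset)
  then obtain k where k: "bij_betw k J E"
    using finite_same_card_bij[of J E] by auto
  obtain h where h: "bij_betw h I (UNIV :: 'm set)"
    using finite_same_card_bij[of I "UNIV :: 'm set"] I by auto
  define hi where "hi = inv_into I h"
  define ki where "ki = inv_into J k"
  have hi: "hi (h i) = i" if "i \<in> I" for i
    using h that by (simp add: hi_def bij_betw_def)
  have ki: "ki (k j) = j" if "j \<in> J" for j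
    using k that by (simp add: ki_def bij_betw_def)
  have hi_bij: "bij_betw hi UNIV I" and ki_bij: "bij_betw ki E J"
    using h k by (simp_all add: hi_def ki_def bij_betw_inv_into)
  have split: "(\<Sum>i\<in>UNIV. f i) = (\<Sum>i\<in>I. f i) + (\<Sum>j\<in>J. f j)" for f :: "'n \<Rightarrow> real"
    unfolding J_def by (metis Compl_eq_Diff_UNIV add.commute finite finite_Diff sum.subset_diff top_greatest)
  define B :: "real ^ 'n ^ 'n" where "B = (\<chi> a i. if i \<in> I then V $ a $ h i else sqrt \<sigma> * k i $ a)"
  have B_I: "B $ a $ i = V $ a $ h i" if "i \<in> I" for a i using that by (simp add: B_def)
  have B_J: "B $ a $ i = sqrt \<sigma> * k i $ a" if "i \<in> J" for a i using that by (simp add: B_def J_def)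
  have Bz: "B *v z = V *v (\<chi> m. z $ hi m) + (\<Sum>u\<in>E. (sqrt \<sigma> * z $ ki u) *\<^sub>R u)" for z
  proof (subst vec_eq_iff, intro allI)
    fix a
    have "(B *v z) $ a = (\<Sum>i\<in>I. B $ a $ i * z $ i) + (\<Sum>i\<in>J. B $ a $ i * z $ i)"
      by (simp add: matrix_vector_mult_def split)
    also have "(\<Sum>i\<in>I. B $ a $ i * z $ i) = (\<Sum>i\<in>I. V $ a $ h i * z $ hi (h i))"
      by (intro sum.cong) (auto simp: B_I hi)
    also have "\<dots> = (V *v (\<chi> m. z $ hi m)) $ a"
      using sum.reindex_bij_betw[OF h, of "\<lambda>m. V $ a $ m * z $ hi m"] by (simp add: matrix_vector_mult_def)
    also have "(\<Sum>i\<in>J. B $ a $ i * z $ i) = (\<Sum>i\<in>J. (sqrt \<sigma> * z $ ki (k i)) * k i $ a)"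
      by (intro sum.cong) (auto simp: B_J ki)
    also have "\<dots> = (\<Sum>u\<in>E. (sqrt \<sigma> * z $ ki u) *\<^sub>R u) $ a"
      using sum.reindex_bij_betw[OF k, of "\<lambda>u. (sqrt \<sigma> * z $ ki u) * u $ a"] by simp
    finally show "(B *v z) $ a = (V *v (\<chi> m. z $ hi m) + (\<Sum>u\<in>E. (sqrt \<sigma> * z $ ki u) *\<^sub>R u)) $ a"
      by simp
  qed
  have BB: "B ** transpose B = V ** transpose V + \<sigma> *\<^sub>R P"
  proof (subst vec_eq_iff, subst vec_eq_iff, intro allI)
    fix a b
    have "(B ** transpose B) $ a $ b = (\<Sum>i\<in>I. B $ a $ i * B $ b $ i) + (\<Sum>i\<in>J. B $ a $ i * B $ b $ i)"
      by (simp add: matrix_matrix_mult_def transpose_def split)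
    also have "(\<Sum>i\<in>I. B $ a $ i * B $ b $ i) = (\<Sum>i\<in>I. V $ a $ h i * V $ b $ h i)"
      by (intro sum.cong) (auto simp: B_I)
    also have "\<dots> = (V ** transpose V) $ a $ b"
      using sum.reindex_bij_betw[OF h, of "\<lambda>m. V $ a $ m * V $ b $ m"]
      by (simp add: matrix_matrix_mult_def transpose_def)
    also have "(\<Sum>i\<in>J. B $ a $ i * B $ b $ i) = (\<Sum>i\<in>J. \<sigma> * (k i $ a * k i $ b))"
      using \<sigma> by (intro sum.cong) (auto simp: B_J mult_ac)
    also have "\<dots> = (\<Sum>u\<in>E. \<sigma> * (u $ a * u $ b))"
      using sum.reindex_bij_betw[OF k, of "\<lambda>u. \<sigma> * (u $ a * u $ b)"] by simp
    also have "\<dots> = (\<sigma> *\<^sub>R P) $ a $ b"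
      by (subst is_projection_entries[OF P]) (simp add: sum_distrib_left)
    finally show "(B ** transpose B) $ a $ b = (V ** transpose V + \<sigma> *\<^sub>R P) $ a $ b" by simp
  qed
  have "z = 0" if z: "B *v z = 0" for z
  proof -
    have "L *v (B *v z) = (L ** V) *v (\<chi> m. z $ hi m)"
      unfolding Bz by (simp add: matrix_vector_right_distrib matrix_vector_mul_assoc
          linear_sum[OF matrix_vector_mul_linear] matrix_vector_mult_scaleR LE)
    then have "(L ** V) *v (\<chi> m. z $ hi m) = 0" by (simp add: z)
    then have 0: "(\<chi> m. z $ hi m) = 0"
      using LV by (metis invertible_left_inverse matrix_left_invertible_ker)
    then have "(\<Sum>u\<in>E. (sqrt \<sigma> * z $ ki u) *\<^sub>R u) = 0" using Bz[of z] z by simp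
    then have "sqrt \<sigma> * z $ ki u = 0" if "u \<in> E" for u
      using orthonormal_inner_sum[OF E that, of "\<lambda>u. sqrt \<sigma> * z $ ki u"] by simp
    then have J: "z $ ki u = 0" if "u \<in> E" for u using \<sigma> that by auto
    have "z $ i = 0" for i
    proof (cases "i \<in> I")
      case True
      then show ?thesis using 0 hi[OF True] by (auto simp: vec_eq_iff dest: spec[of _ "h i"])
    next
      case False
      then have "i \<in> J" by (simp add: J_def)
      then show ?thesis using J[of "k i"] ki[of i] k by (auto simp: bij_betw_def)
    qed
    then show ?thesis by (simp add: vec_eq_iff)
  qed
  then have "invertible B"
    by (simp add: invertible_left_inverse matrix_left_invertible_ker)
  from gaussian_eq_distr[OF this, of \<mu>]
  have g: "gaussian \<mu> (V ** transpose V + \<sigma> *\<^sub>R P) = distr std_gaussian borel (\<lambda>z. \<mu> + B *v z)"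
    by (simp add: BB)
  let ?N = "\<lambda>K :: 'n set. \<Pi>\<^sub>M i\<in>K. normal_measure 1"
  interpret product_sigma_finite "\<lambda>_::'n. normal_measure 1"
    by (simp add: product_sigma_finite_def prob_space_imp_sigma_finite[OF prob_space_normal_measure])
  \<comment> \<open>This is the source of the independence of \<open>z\<close> and the coefficients
    \<open>w\<close>: the product over all coordinates is the product of the two blocks.\<close>
  have merge: "?N UNIV = distr (?N J \<Otimes>\<^sub>M ?N I) (?N UNIV) (merge J I)"
    using distr_merge[of J I] by (simp add: J_def)
  have merge_measurable [measurable]: "merge J I \<in> ?N J \<Otimes>\<^sub>M ?N I \<rightarrow>\<^sub>M ?N UNIV"
    using measurable_merge[of J I "\<lambda>_. normal_measure 1"] by (simp add: J_def)
  define T1 where "T1 = (\<lambda>\<omega>. (\<chi> m. \<omega> (hi m)) :: real ^ 'm)"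
  define T2 where "T2 = (\<lambda>\<omega>. \<lambda>u\<in>E. sqrt \<sigma> * \<omega> (ki u))"
  have T1m [measurable]: "T1 \<in> borel_measurable (?N I)"
    unfolding T1_def
  proof (rule borel_measurable_vec_lambda)
    fix m
    have "hi m \<in> I" using hi_bij by (auto simp: bij_betw_def)
    then show "(\<lambda>x. x (hi m)) \<in> borel_measurable (?N I)" by measurable
  qed
  have T1: "distr (?N I) borel T1 = std_gaussian"
  proof -
    have "distr (?N I) (\<Pi>\<^sub>M m\<in>(UNIV :: 'm set). normal_measure 1) (\<lambda>\<omega>. \<lambda>m\<in>UNIV. \<omega> (hi m)) = (\<Pi>\<^sub>M m\<in>(UNIV :: 'm set). normal_measure 1)"
      using hi_bij by (intro distr_PiM_reindex prob_space_normal_measure) (auto simp: bij_betw_def)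
    then have "std_gaussian = distr (distr (?N I) (\<Pi>\<^sub>M m\<in>(UNIV :: 'm set). normal_measure 1)
        (\<lambda>\<omega>. \<lambda>m\<in>UNIV. \<omega> (hi m))) borel (vec_lambda :: _ \<Rightarrow> real ^ 'm)"
      by (simp add: std_gaussian_eq_distr_PiM)
    also have "\<dots> = distr (?N I) borel T1"
    proof (subst distr_distr)
      have "hi m \<in> I" for m using hi_bij by (auto simp: bij_betw_def)
      then show "(\<lambda>\<omega>. \<lambda>m\<in>UNIV. \<omega> (hi m)) \<in> ?N I \<rightarrow>\<^sub>M (\<Pi>\<^sub>M m\<in>(UNIV :: 'm set). normal_measure 1)"
        by (intro measurable_restrict measurable_component_singleton) auto
    qed (auto simp: T1_def comp_def restrict_UNIV)
    finally show ?thesis by simp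
  qed
  have kiJ: "ki u \<in> J" if "u \<in> E" for u using ki_bij that by (auto simp: bij_betw_def)
  have T2m [measurable]: "T2 \<in> ?N J \<rightarrow>\<^sub>M (\<Pi>\<^sub>M u\<in>E. borel)"
    unfolding T2_def
  proof (rule measurable_restrict)
    fix u assume "u \<in> E"
    then have "ki u \<in> J" by (rule kiJ)
    then show "(\<lambda>x. sqrt \<sigma> * x (ki u)) \<in> borel_measurable (?N J)" by measurable
  qed
  \<comment> \<open>\<open>T2\<close> picks the coordinates in \<open>J\<close>, renames them by
    \<open>E\<close> and multiplies them by \<open>sqrt \<sigma>\<close>, which becomes the standard
    deviation.\<close>
  have T2: "distr (?N J) (\<Pi>\<^sub>M u\<in>E. borel) T2 = (\<Pi>\<^sub>M u\<in>E. normal_measure (sqrt \<sigma>))"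
  proof -
    interpret std: prob_space "normal_measure 1" by (rule prob_space_normal_measure) simp
    have "distributed (normal_measure 1) lborel (\<lambda>x. x) std_normal_density"
      by (simp add: distributed_def distr_id2)
    from std.normal_density_affine[OF this, of "sqrt \<sigma>" 0]
    have scale: "distr (normal_measure 1) (normal_measure 1) ((*) (sqrt \<sigma>)) = normal_measure (sqrt \<sigma>)"
      using \<sigma> by (simp add: distributed_def cong: distr_cong)
    have "(\<Pi>\<^sub>M u\<in>E. normal_measure (sqrt \<sigma>)) =
        distr (\<Pi>\<^sub>M u\<in>E. normal_measure 1) (\<Pi>\<^sub>M u\<in>E. normal_measure 1) (compose E ((*) (sqrt \<sigma>)))"
      by (subst scale[symmetric], rule distr_PiM_finite_prob_space[symmetric])
         (auto intro!: product_prob_spaceI prob_space_normal_measure)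
    also have "\<dots> = distr (\<Pi>\<^sub>M u\<in>E. normal_measure 1) (\<Pi>\<^sub>M u\<in>E. borel) (compose E ((*) (sqrt \<sigma>)))"
      by (intro distr_cong sets_PiM_cong) auto
    also have "(\<Pi>\<^sub>M u\<in>E. normal_measure 1) = distr (?N J) (\<Pi>\<^sub>M u\<in>E. normal_measure 1) (\<lambda>\<omega>. \<lambda>u\<in>E. \<omega> (ki u))"
      using ki_bij by (intro distr_PiM_reindex[symmetric] prob_space_normal_measure) (auto simp: bij_betw_def)
    also have "distr \<dots> (\<Pi>\<^sub>M u\<in>E. borel) (compose E ((*) (sqrt \<sigma>))) = distr (?N J) (\<Pi>\<^sub>M u\<in>E. borel) T2"
    proof (subst distr_distr)
      show "(\<lambda>\<omega>. \<lambda>u\<in>E. \<omega> (ki u)) \<in> ?N J \<rightarrow>\<^sub>M (\<Pi>\<^sub>M u\<in>E. normal_measure 1)"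
        using kiJ by (intro measurable_restrict measurable_component_singleton) auto
      show "compose E ((*) (sqrt \<sigma>)) \<in> (\<Pi>\<^sub>M u\<in>E. normal_measure 1) \<rightarrow>\<^sub>M (\<Pi>\<^sub>M u\<in>E. borel)"
        unfolding compose_def by measurable
    qed (auto simp: T2_def comp_def compose_def restrict_def intro!: distr_cong)
    finally show ?thesis by simp
  qed
  have "distr ((\<Pi>\<^sub>M u\<in>E. normal_measure (sqrt \<sigma>)) \<Otimes>\<^sub>M std_gaussian) borel
      (\<lambda>(w, z). \<mu> + V *v z + (\<Sum>u\<in>E. w u *\<^sub>R u)) =
      distr (distr (?N J \<Otimes>\<^sub>M ?N I) ((\<Pi>\<^sub>M u\<in>E. borel) \<Otimes>\<^sub>M borel) (\<lambda>(x, y). (T2 x, T1 y))) borel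
      (\<lambda>(w, z). \<mu> + V *v z + (\<Sum>u\<in>E. w u *\<^sub>R u))"
    unfolding T1[symmetric] T2[symmetric]
    by (subst pair_measure_distr)
       (auto simp: T1 intro!: prob_space_imp_sigma_finite prob_space_std_gaussian)
  also have "\<dots> = distr (?N J \<Otimes>\<^sub>M ?N I) borel (\<lambda>(x, y). \<mu> + V *v T1 y + (\<Sum>u\<in>E. T2 x u *\<^sub>R u))"
    by (subst distr_distr) (auto simp: comp_def case_prod_unfold)
  also have "\<dots> = distr (?N J \<Otimes>\<^sub>M ?N I) borel (\<lambda>xy. \<mu> + B *v vec_lambda (merge J I xy))"
  proof (intro distr_cong refl)
    fix xy assume "xy \<in> space (?N J \<Otimes>\<^sub>M ?N I)"
    obtain x y where xy: "xy = (x, y)" by fastforce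
    have "merge J I (x, y) (hi m) = y (hi m)" for m
      using hi_bij by (auto simp: merge_def bij_betw_def J_def)
    moreover have "merge J I (x, y) (ki u) = x (ki u)" if "u \<in> E" for u
      using kiJ[OF that] by (auto simp: merge_def)
    ultimately show "(case xy of (x, y) \<Rightarrow> \<mu> + V *v T1 y + (\<Sum>u\<in>E. T2 x u *\<^sub>R u)) =
        \<mu> + B *v vec_lambda (merge J I xy)"
      by (simp add: xy Bz T1_def T2_def add.assoc cong: sum.cong)
  qed
  also have "\<dots> = distr (?N UNIV) borel (\<lambda>x. \<mu> + B *v vec_lambda x)"
    by (subst merge, subst distr_distr[OF _ merge_measurable]) (auto simp: comp_def)
  also have "\<dots> = distr std_gaussian borel (\<lambda>z. \<mu> + B *v z)"
    unfolding std_gaussian_eq_distr_PiM by (subst distr_distr) (auto simp: comp_def)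
  finally show ?thesis using g by simp
qed

section \<open>Disintegration and the residual\<close>

lemma nn_integral_swap:
  assumes "sigma_finite_measure M" "sigma_finite_measure N"
    and "(\<lambda>(x, y). f x y) \<in> borel_measurable (M \<Otimes>\<^sub>M N)"
  shows "(\<integral>\<^sup>+ x. \<integral>\<^sup>+ y. f x y \<partial>N \<partial>M) = (\<integral>\<^sup>+ y. \<integral>\<^sup>+ x. f x y \<partial>M \<partial>N)"
proof -
  interpret pair_sigma_finite M N using assms by (simp add: pair_sigma_finite_def)
  show ?thesis using Fubini'[OF assms(3)] by simp
qed

lemma nn_integral_pair:
  assumes "sigma_finite_measure N" "f \<in> borel_measurable (M \<Otimes>\<^sub>M N)"
  shows "(\<integral>\<^sup>+ z. f z \<partial>(M \<Otimes>\<^sub>M N)) = (\<integral>\<^sup>+ x. \<integral>\<^sup>+ y. f (x, y) \<partial>N \<partial>M)"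
  using sigma_finite_measure.nn_integral_fst[OF assms] by simp

text \<open>The definition tests the conditional law on rectangles only. These form an
  intersection-stable generator, so the joint law of \<open>X\<close> and \<open>Z\<close> is the
  mixture of the kernel over \<open>M\<close>, and integrals of all nonnegative measurable functions
  follow.\<close>

lemma regular_cond_dist_nn_integral:
  assumes M: "prob_space M" and R: "regular_cond_dist M N X L Z K"
    and f: "f \<in> borel_measurable (N \<Otimes>\<^sub>M L)"
  shows "(\<integral>\<^sup>+ \<omega>. f (X \<omega>, Z \<omega>) \<partial>M) = (\<integral>\<^sup>+ \<omega>. \<integral>\<^sup>+ x. f (x, Z \<omega>) \<partial>K (Z \<omega>) \<partial>M)"
proof -
  interpret prob_space M by fact
  note [measurable] = f
  have [measurable]: "X \<in> M \<rightarrow>\<^sub>M N" "Z \<in> M \<rightarrow>\<^sub>M L" and K: "K \<in> L \<rightarrow>\<^sub>M prob_algebra N"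
    and eq: "\<And>A B. A \<in> sets N \<Longrightarrow> B \<in> sets L \<Longrightarrow> emeasure M {\<omega> \<in> space M. X \<omega> \<in> A \<and> Z \<omega> \<in> B} =
        (\<integral>\<^sup>+ \<omega>. emeasure (K (Z \<omega>)) A * indicator B (Z \<omega>) \<partial>M)"
    using R by (auto simp: regular_cond_dist_def)
  \<comment> \<open>The kernel is paired with a frozen second coordinate so that the joint law
    becomes a single \<open>bind\<close>.\<close>
  define J where "J = (\<lambda>\<omega>. distr (K (Z \<omega>)) (N \<Otimes>\<^sub>M L) (\<lambda>x. (x, Z \<omega>)))"
  have KZ: "sets (K (Z \<omega>)) = sets N" "prob_space (K (Z \<omega>))" if "\<omega> \<in> space M" for \<omega>
    using measurable_space[OF K, of "Z \<omega>"] measurable_space[OF \<open>Z \<in> M \<rightarrow>\<^sub>M L\<close> that]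
    by (auto simp: space_prob_algebra)
  have "(\<lambda>\<omega>. K (Z \<omega>)) \<in> M \<rightarrow>\<^sub>M prob_algebra N"
    using K by measurable
  then have J: "J \<in> M \<rightarrow>\<^sub>M prob_algebra (N \<Otimes>\<^sub>M L)"
    unfolding J_def by (rule measurable_distr_prob_space2) measurable
  then have Js [measurable]: "J \<in> M \<rightarrow>\<^sub>M subprob_algebra (N \<Otimes>\<^sub>M L)" by (rule measurable_prob_algebraD)
  have ne: "space M \<noteq> {}" by (rule not_empty)
  have pair: "(\<lambda>x. (x, Z \<omega>)) \<in> K (Z \<omega>) \<rightarrow>\<^sub>M N \<Otimes>\<^sub>M L" if "\<omega> \<in> space M" for \<omega>
    using measurable_space[OF \<open>Z \<in> M \<rightarrow>\<^sub>M L\<close> that] by (simp add: KZ(1)[OF that] cong: measurable_cong_sets)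
  have "distr M (N \<Otimes>\<^sub>M L) (\<lambda>\<omega>. (X \<omega>, Z \<omega>)) = bind M J"
  proof (rule measure_eqI_generator_eq)
    let ?E = "{a \<times> b |a b. a \<in> sets N \<and> b \<in> sets L}"
    show "Int_stable ?E" by (rule Int_stable_pair_measure_generator)
    show "?E \<subseteq> Pow (space N \<times> space L)"
      by (auto dest: sets.sets_into_space)
    show "sets (distr M (N \<Otimes>\<^sub>M L) (\<lambda>\<omega>. (X \<omega>, Z \<omega>))) = sigma_sets (space N \<times> space L) ?E"
      by (simp add: sets_pair_measure)
    show "sets (bind M J) = sigma_sets (space N \<times> space L) ?E"
      using sets_bind[OF sets_kernel[OF Js] ne] by (simp add: sets_pair_measure)
    show "range (\<lambda>_::nat. space N \<times> space L) \<subseteq> ?E" "(\<Union>i::nat. space N \<times> space L) = space N \<times> space L"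
      by auto
    show "emeasure (distr M (N \<Otimes>\<^sub>M L) (\<lambda>\<omega>. (X \<omega>, Z \<omega>))) (space N \<times> space L) \<noteq> \<infinity>"
      by (subst emeasure_distr) auto
    fix C assume "C \<in> ?E"
    then obtain A B where C: "C = A \<times> B" and [measurable]: "A \<in> sets N" "B \<in> sets L" by auto
    have "emeasure (distr M (N \<Otimes>\<^sub>M L) (\<lambda>\<omega>. (X \<omega>, Z \<omega>))) C = emeasure M {\<omega> \<in> space M. X \<omega> \<in> A \<and> Z \<omega> \<in> B}"
      unfolding C by (subst emeasure_distr) (auto intro!: arg_cong2[where f = emeasure])
    also have "\<dots> = (\<integral>\<^sup>+ \<omega>. emeasure (J \<omega>) C \<partial>M)"
    proof (subst eq, simp, simp, rule nn_integral_cong)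
      fix \<omega> assume \<omega>: "\<omega> \<in> space M"
      have "emeasure (J \<omega>) C = emeasure (K (Z \<omega>)) ((\<lambda>x. (x, Z \<omega>)) -` C \<inter> space (K (Z \<omega>)))"
        unfolding J_def by (subst emeasure_distr[OF pair[OF \<omega>]]) (auto simp: C)
      also have "(\<lambda>x. (x, Z \<omega>)) -` C \<inter> space (K (Z \<omega>)) = (if Z \<omega> \<in> B then A else {})"
        using sets.sets_into_space[OF \<open>A \<in> sets N\<close>] sets_eq_imp_space_eq[OF KZ(1)[OF \<omega>]] by (auto simp: C)
      finally show "emeasure (K (Z \<omega>)) A * indicator B (Z \<omega>) = emeasure (J \<omega>) C" by simp
    qed
    also have "\<dots> = emeasure (bind M J) C"
      by (rule emeasure_bind[symmetric, OF ne Js]) (simp add: C)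
    finally show "emeasure (distr M (N \<Otimes>\<^sub>M L) (\<lambda>\<omega>. (X \<omega>, Z \<omega>))) C = emeasure (bind M J) C" .
  qed
  moreover have "(\<integral>\<^sup>+ \<omega>. f (X \<omega>, Z \<omega>) \<partial>M) = (\<integral>\<^sup>+ y. f y \<partial>distr M (N \<Otimes>\<^sub>M L) (\<lambda>\<omega>. (X \<omega>, Z \<omega>)))"
    by (subst nn_integral_distr) auto
  ultimately have "(\<integral>\<^sup>+ \<omega>. f (X \<omega>, Z \<omega>) \<partial>M) = (\<integral>\<^sup>+ y. f y \<partial>bind M J)" by simp
  also have "\<dots> = (\<integral>\<^sup>+ \<omega>. \<integral>\<^sup>+ y. f y \<partial>J \<omega> \<partial>M)"
    by (rule nn_integral_bind[OF f Js])
  also have "\<dots> = (\<integral>\<^sup>+ \<omega>. \<integral>\<^sup>+ x. f (x, Z \<omega>) \<partial>K (Z \<omega>) \<partial>M)"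
    unfolding J_def by (intro nn_integral_cong, subst nn_integral_distr[OF pair]) auto
  finally show ?thesis .
qed

section \<open>Gaussian densities on a subspace, written in ambient coordinates\<close>

definition gauss_kernel :: "real \<Rightarrow> real \<Rightarrow> real \<Rightarrow> real" where
  "gauss_kernel p \<tau> q = (2 * pi * \<tau>) powr (- p / 2) * exp (- q / (2 * \<tau>))"

lemma gauss_kernel_nonneg: "gauss_kernel p \<tau> q \<ge> 0"
  by (simp add: gauss_kernel_def)

lemma gauss_kernel_pos: "\<tau> > 0 \<Longrightarrow> gauss_kernel p \<tau> q > 0"
  by (simp add: gauss_kernel_def)

lemma measurable_gauss_kernel [measurable (raw)]:
  assumes [measurable]: "f \<in> borel_measurable M" "g \<in> borel_measurable M"
  shows "(\<lambda>x. gauss_kernel p (f x) (g x)) \<in> borel_measurable M"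
  unfolding gauss_kernel_def by measurable

text \<open>Taking a real dimension and a squared norm as arguments lets independent copies multiply
  by adding dimensions and squared norms. The \<open>k\<close> observations thus act like one
  Gaussian vector of dimension \<open>k * l\<close>.\<close>

lemma prod_gauss_kernel:
  assumes "finite I" "\<tau> > 0"
  shows "(\<Prod>i\<in>I. gauss_kernel p \<tau> (q i)) = gauss_kernel (real (card I) * p) \<tau> (\<Sum>i\<in>I. q i)"
proof -
  have "(\<Prod>i\<in>I. exp (- q i / (2 * \<tau>))) = exp (- (\<Sum>i\<in>I. q i) / (2 * \<tau>))"
    by (simp add: exp_sum[OF assms(1), symmetric] sum_negf sum_divide_distrib)
  moreover have "(c powr (- p / 2)) ^ card I = c powr (- (real (card I) * p) / 2)" if "c > 0" for c :: real
    using that by (simp add: powr_powr mult.commute flip: powr_realpow)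
  ultimately show ?thesis using assms(2) by (simp add: gauss_kernel_def prod.distrib)
qed

text \<open>A measure on the ambient space, so that integrands remain functions of ambient vectors.
  For empty \<open>E\<close> it is the point mass at 0.\<close>

definition subspace_lebesgue :: "'a::euclidean_space set \<Rightarrow> 'a measure" where
  "subspace_lebesgue E = distr (\<Pi>\<^sub>M u\<in>E. lborel) borel (\<lambda>y. \<Sum>u\<in>E. y u *\<^sub>R u)"

lemma space_subspace_lebesgue [simp]: "space (subspace_lebesgue E) = UNIV"
  and sets_subspace_lebesgue [simp, measurable_cong]: "sets (subspace_lebesgue E) = sets borel"
  by (simp_all add: subspace_lebesgue_def)

text \<open>Orthonormality turns the sum of squared coordinates into the squared norm of the image
  point, so the product density is a function of that point and passes to the image measure.\<close>

lemma distr_PiM_normal_measure: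
  fixes E :: "'a::euclidean_space set"
  assumes E: "orthonormal E" and \<tau>: "\<tau> > 0"
  shows "distr (\<Pi>\<^sub>M u\<in>E. normal_measure (sqrt \<tau>)) borel (\<lambda>w. \<Sum>u\<in>E. w u *\<^sub>R u) =
    density (subspace_lebesgue E) (\<lambda>b. ennreal (gauss_kernel (card E) \<tau> ((norm b)\<^sup>2)))"
proof -
  have [simp]: "finite E" using E by (rule orthonormal_finite)
  let ?S = "\<lambda>w. \<Sum>u\<in>E. w u *\<^sub>R u"
  have "(\<Pi>\<^sub>M u\<in>E. normal_measure (sqrt \<tau>)) =
      density (\<Pi>\<^sub>M u\<in>E. lborel) (\<lambda>x. \<Prod>u\<in>E. ennreal (normal_density 0 (sqrt \<tau>) (x u)))"
    using \<tau> by (intro PiM_density)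
      (auto intro: sigma_finite_lborel prob_space_imp_sigma_finite[OF prob_space_normal_measure])
  also have "\<dots> = density (\<Pi>\<^sub>M u\<in>E. lborel) (\<lambda>x. ennreal (gauss_kernel (card E) \<tau> ((norm (?S x))\<^sup>2)))"
    using \<tau> by (simp add: prod_ennreal prod_normal_density gauss_kernel_def orthonormal_norm_sum[OF E])
  finally show ?thesis
    unfolding subspace_lebesgue_def by (simp add: density_distr)
qed

text \<open>In the application \<open>L\<close> is \<open>transpose W ** A\<close>, \<open>P\<close>
  is \<open>P2\<close>, and \<open>E\<close> is an orthonormal basis of the span of the
  \<open>y j\<close>. The assumptions imply that \<open>span E\<close> and the range of
  \<open>V\<close> are complementary.\<close>

locale conditioned_model =
  fixes V :: "real ^ 'm ^ 'n" and L :: "real ^ 'n ^ 'm" and P :: "real ^ 'n ^ 'n" and E :: "(real ^ 'n) set"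
  assumes proj: "is_projection P E" and card_E: "card E + CARD('m) = CARD('n)"
    and LV: "invertible (L ** V)" and L_span: "\<And>u. u \<in> span E \<Longrightarrow> L *v u = 0"
begin

text \<open>The matrix \<open>P1\<close>. By the next two lemmas it is the projection onto
  \<open>span E\<close> along the range of \<open>V\<close>, in general not an orthogonal
  one.\<close>

definition "oblique = mat 1 - V ** matrix_inv (L ** V) ** L"

lemma oblique_range: "oblique *v (V *v z) = 0"
proof -
  have "V ** matrix_inv (L ** V) ** L ** V = V"
    using matrix_inv_inverse(2)[OF LV] by (metis matrix_mul_assoc matrix_mul_rid)
  then show ?thesis
    unfolding oblique_def matrix_vector_mult_diff_rdistrib by (simp add: matrix_vector_mul_assoc)
qed

lemma oblique_span: "u \<in> span E \<Longrightarrow> oblique *v u = u"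
  by (simp add: oblique_def matrix_vector_mult_diff_rdistrib L_span flip: matrix_vector_mul_assoc)

lemma orthonormal_E: "orthonormal E"
  using proj by (simp add: is_projection_def)

abbreviation \<open>prior \<mu> \<sigma> \<equiv> gaussian \<mu> (V ** transpose V + \<sigma> *\<^sub>R P)\<close>

text \<open>The oblique projection removes \<open>V *v z\<close> and keeps the Gaussian part in
  \<open>span E\<close>. The basis \<open>E'\<close> of that span is arbitrary while the left-hand
  side does not mention it, so two bases can be compared through this one law.\<close>

lemma residual_law_aux:
  assumes E': "is_projection P E'" "span E' = span E" and \<sigma>: "\<sigma> > 0"
  shows "distr (prior \<mu> \<sigma>) borel (\<lambda>v. oblique *v (v - \<mu>)) =
     density (subspace_lebesgue E') (\<lambda>b. ennreal (gauss_kernel (card E) \<sigma> ((norm b)\<^sup>2)))"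
proof -
  have o: "orthonormal E'" using E' by (simp add: is_projection_def)
  have card: "card E' = card E"
    using E'(2) orthonormal_independent[OF o] orthonormal_independent[OF orthonormal_E]
    by (metis dim_eq_card_independent dim_span)
  have in_span: "(\<Sum>u\<in>E'. w u *\<^sub>R u) \<in> span E" for w
    unfolding E'(2)[symmetric] by (auto intro: span_sum[OF span_mul[OF span_base]])
  let ?N = "\<Pi>\<^sub>M u\<in>E'. normal_measure (sqrt \<sigma>)"
  interpret std: prob_space "std_gaussian :: (real ^ 'm) measure" by (rule prob_space_std_gaussian)
  have L0: "L *v u = 0" if "u \<in> E'" for u using that E'(2) L_span span_base by metis
  have "distr (prior \<mu> \<sigma>) borel (\<lambda>v. oblique *v (v - \<mu>)) =
     distr (?N \<Otimes>\<^sub>M (std_gaussian :: (real ^ 'm) measure)) borel (\<lambda>(w, z). \<Sum>u\<in>E'. w u *\<^sub>R u)"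
    using card_E \<sigma>
    by (subst gaussian_prior_decomposition[OF E'(1) _ LV L0], simp_all add: card)
       (subst distr_distr, auto simp: comp_def case_prod_unfold matrix_vector_right_distrib
           oblique_range oblique_span[OF in_span] add.assoc)
  also have "\<dots> = distr (distr (?N \<Otimes>\<^sub>M (std_gaussian :: (real ^ 'm) measure)) ?N fst) borel (\<lambda>w. \<Sum>u\<in>E'. w u *\<^sub>R u)"
    by (subst distr_distr) (auto simp: comp_def case_prod_unfold)
  also have "\<dots> = distr ?N borel (\<lambda>w. \<Sum>u\<in>E'. w u *\<^sub>R u)"
    by (simp add: std.distr_pair_fst)
  finally show ?thesis using distr_PiM_normal_measure[OF o \<sigma>] by (simp add: card)
qed

text \<open>The Gaussian law of the residual does not involve the basis, and dividing by its density
  recovers the Lebesgue measure of the subspace.\<close>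

lemma subspace_lebesgue_eq_density:
  assumes E': "is_projection P E'" "span E' = span E"
  shows "subspace_lebesgue E' = density (distr (prior 0 1) borel (\<lambda>v. oblique *v (v - 0)))
     (\<lambda>b. ennreal (1 / gauss_kernel (card E) 1 ((norm b)\<^sup>2)))"
proof -
  have "ennreal (gauss_kernel (card E) 1 q) * ennreal (1 / gauss_kernel (card E) 1 q) = 1" for q
    using gauss_kernel_pos[of 1 "card E" q] by (simp flip: ennreal_mult')
  then show ?thesis
    unfolding residual_law_aux[OF E' zero_less_one]
    by (subst density_density_eq) (auto simp: density_1)
qed

text \<open>The density representation just proved has a right-hand side free of \<open>E'\<close>.
  This identifies the base measure chosen inside \<open>student\<close> with that of
  \<open>E\<close>.\<close>

lemma subspace_lebesgue_basis:
  assumes E': "is_projection P E'" "span E' = span E"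
  shows "subspace_lebesgue E' = subspace_lebesgue E"
  using subspace_lebesgue_eq_density[OF E'] subspace_lebesgue_eq_density[OF proj refl] by simp

lemma residual_law:
  assumes \<sigma>: "\<sigma> > 0"
  shows "distr (prior \<mu> \<sigma>) borel (\<lambda>v. oblique *v (v - \<mu>)) =
     density (subspace_lebesgue E) (\<lambda>b. ennreal (gauss_kernel (card E) \<sigma> ((norm b)\<^sup>2)))"
  using residual_law_aux[OF proj refl \<sigma>] .

lemma prob_space_prior:
  assumes \<sigma>: "\<sigma> > 0" shows "prob_space (prior \<mu> \<sigma>)"
proof -
  have "prob_space ((\<Pi>\<^sub>M u\<in>E. normal_measure (sqrt \<sigma>)) \<Otimes>\<^sub>M (std_gaussian :: (real ^ 'm) measure))"
    using \<sigma> by (intro prob_space_pair prob_space_PiM prob_space_normal_measure prob_space_std_gaussian) auto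
  then show ?thesis
    using \<sigma> L_span
    by (subst gaussian_prior_decomposition[OF proj card_E LV]) 
       (auto intro!: prob_space.prob_space_distr span_base)
qed

lemma sets_prior [simp, measurable_cong]: "sets (prior \<mu> \<sigma>) = sets borel"
  by (simp add: gaussian_def)

lemma prob_space_residual: "\<sigma> > 0 \<Longrightarrow>
   prob_space (density (subspace_lebesgue E) (\<lambda>b. ennreal (gauss_kernel (card E) \<sigma> ((norm b)\<^sup>2))))"
  unfolding residual_law[symmetric, of _ 0]
  by (intro prob_space.prob_space_distr prob_space_prior) (auto cong: measurable_cong_sets)

text \<open>An image of a sigma-finite measure can fail to be sigma-finite. This one has a
  finite-valued density with respect to a probability measure.\<close>

lemma sigma_finite_subspace_lebesgue: "sigma_finite_measure (subspace_lebesgue E)"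
proof -
  interpret sigma_finite_measure "distr (prior 0 1) borel (\<lambda>v. oblique *v (v - 0))"
    unfolding residual_law[OF zero_less_one]
    by (intro prob_space_imp_sigma_finite prob_space_residual) simp
  show ?thesis
    unfolding subspace_lebesgue_eq_density[OF proj refl]
    by (subst sigma_finite_iff_density_finite) auto
qed

end

section \<open>Conjugacy and the Student mixture\<close>

context conditioned_model
begin

abbreviation (input) \<open>leb \<equiv> subspace_lebesgue E\<close>

text \<open>The reference measure for the observations, the same for every variance. Ambient
  Lebesgue measure would not serve, as the observations lie in the proper subspace
  \<open>span E\<close> almost surely.\<close>

definition "obs_leb = (\<Pi>\<^sub>M j\<in>UNIV. leb)"

definition sq_sum :: "('k::finite \<Rightarrow> real ^ 'n) \<Rightarrow> real" where
  "sq_sum \<xi> = (\<Sum>j\<in>UNIV. (norm (\<xi> j))\<^sup>2)"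

lemma sets_obs_leb [simp, measurable_cong]: "sets obs_leb = sets (\<Pi>\<^sub>M j\<in>UNIV. borel)"
  unfolding obs_leb_def by (intro sets_PiM_cong) auto

lemma measurable_sq_sum [measurable]: "sq_sum \<in> borel_measurable (\<Pi>\<^sub>M j\<in>UNIV. borel)"
  unfolding sq_sum_def by measurable

lemma sigma_finite_obs_leb: "sigma_finite_measure (obs_leb :: ('k::finite \<Rightarrow> _) measure)"
proof -
  interpret finite_product_sigma_finite "\<lambda>_::'k. leb" UNIV
    by (simp add: finite_product_sigma_finite_def product_sigma_finite_def
        finite_product_sigma_finite_axioms_def sigma_finite_subspace_lebesgue)
  show ?thesis unfolding obs_leb_def by (rule sigma_finite_measure_axioms)
qed

lemma PiM_residual:
  assumes \<sigma>: "\<sigma> > 0"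
  shows "(\<Pi>\<^sub>M j\<in>(UNIV :: 'k::finite set). distr (prior \<mu> \<sigma>) borel (\<lambda>v. oblique *v (v - \<mu>))) =
    density obs_leb (\<lambda>\<xi>. ennreal (gauss_kernel (real CARD('k) * real (card E)) \<sigma> (sq_sum \<xi>)))"
proof -
  have "(\<Pi>\<^sub>M j\<in>(UNIV :: 'k::finite set). distr (prior \<mu> \<sigma>) borel (\<lambda>v. oblique *v (v - \<mu>))) =
    density obs_leb (\<lambda>\<xi>. \<Prod>j\<in>UNIV. ennreal (gauss_kernel (card E) \<sigma> ((norm (\<xi> j))\<^sup>2)))"
    unfolding residual_law[OF \<sigma>] obs_leb_def
    by (rule PiM_density)
       (auto intro: sigma_finite_subspace_lebesgue prob_space_imp_sigma_finite[OF prob_space_residual[OF \<sigma>]])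
  then show ?thesis
    using \<sigma> by (simp add: prod_ennreal gauss_kernel_nonneg prod_gauss_kernel sq_sum_def)
qed

text \<open>Given the variance, \<open>x\<close> and the observations are independent, and
  \<open>x\<close> splits into \<open>\<mu> + V *v z\<close> and a residual \<open>b\<close>. In
  this form \<open>\<sigma>\<close> enters through the two kernels only; the law of \<open>z\<close>
  and the base measures are free of it, so the integral over \<open>\<sigma>\<close> can later be
  moved inwards.\<close>

lemma nn_integral_likelihood:
  fixes f :: "(real ^ 'n) \<times> ('k::finite \<Rightarrow> real ^ 'n) \<Rightarrow> ennreal"
  assumes \<sigma>: "\<sigma> > 0" and f[measurable]: "f \<in> borel_measurable (borel \<Otimes>\<^sub>M (\<Pi>\<^sub>M j\<in>UNIV. borel))"
  shows "(\<integral>\<^sup>+ y. f y \<partial>(prior \<mu> \<sigma> \<Otimes>\<^sub>M (\<Pi>\<^sub>M j\<in>UNIV. distr (prior \<mu> \<sigma>) borel (\<lambda>v. oblique *v (v - \<mu>))))) =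
    (\<integral>\<^sup>+ z. \<integral>\<^sup>+ \<xi>. \<integral>\<^sup>+ b. ennreal (gauss_kernel (real CARD('k) * real (card E)) \<sigma> (sq_sum \<xi>)) *
       (ennreal (gauss_kernel (card E) \<sigma> ((norm b)\<^sup>2)) * f (\<mu> + V *v z + b, \<xi>))
      \<partial>leb \<partial>obs_leb \<partial>std_gaussian)"
proof -
  let ?D = "density obs_leb (\<lambda>\<xi> :: 'k \<Rightarrow> real ^ 'n. ennreal (gauss_kernel (real CARD('k) * real (card E)) \<sigma> (sq_sum \<xi>)))"
  let ?g = "\<lambda>b. ennreal (gauss_kernel (card E) \<sigma> ((norm b)\<^sup>2))"
  let ?N = "\<Pi>\<^sub>M u\<in>E. normal_measure (sqrt \<sigma>)"
  let ?std = "std_gaussian :: (real ^ 'm) measure"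
  have D: "prob_space ?D"
    unfolding PiM_residual[OF \<sigma>, symmetric, of 0]
    using prob_space_residual[OF \<sigma>] by (intro prob_space_PiM) (simp only: residual_law[OF \<sigma>])
  have std: "sigma_finite_measure ?std" by (intro prob_space_imp_sigma_finite prob_space_std_gaussian)
  have L0: "L *v u = 0" if "u \<in> E" for u using that L_span span_base by metis
  note sf = sigma_finite_subspace_lebesgue sigma_finite_obs_leb std
  \<comment> \<open>Integrating out the observations first leaves a function of \<open>x\<close>
    alone, to which the decomposition of the Gaussian law applies.\<close>
  define h where "h = (\<lambda>v. \<integral>\<^sup>+ \<xi>. f (v, \<xi>) \<partial>?D)"
  interpret D: sigma_finite_measure ?D using D by (rule prob_space_imp_sigma_finite)
  have h_m [measurable]: "h \<in> borel_measurable borel"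
    unfolding h_def by measurable
  have "(\<integral>\<^sup>+ y. f y \<partial>(prior \<mu> \<sigma> \<Otimes>\<^sub>M ?D)) = (\<integral>\<^sup>+ v. h v \<partial>prior \<mu> \<sigma>)"
    unfolding h_def by (rule nn_integral_pair[OF D.sigma_finite_measure_axioms]) measurable
  also have "\<dots> = (\<integral>\<^sup>+ (w, z). h (\<mu> + V *v z + (\<Sum>u\<in>E. w u *\<^sub>R u)) \<partial>(?N \<Otimes>\<^sub>M ?std))"
    by (subst gaussian_prior_decomposition[OF proj card_E LV L0 \<sigma>])
       (auto simp: nn_integral_distr case_prod_unfold)
  also have "\<dots> = (\<integral>\<^sup>+ w. \<integral>\<^sup>+ z. h (\<mu> + V *v z + (\<Sum>u\<in>E. w u *\<^sub>R u)) \<partial>?std \<partial>?N)"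
    by (subst nn_integral_pair[OF std]) auto
  also have "\<dots> = (\<integral>\<^sup>+ z. \<integral>\<^sup>+ w. h (\<mu> + V *v z + (\<Sum>u\<in>E. w u *\<^sub>R u)) \<partial>?N \<partial>?std)"
    using \<sigma> by (intro nn_integral_swap std prob_space_imp_sigma_finite prob_space_PiM prob_space_normal_measure)
        auto
  also have "\<dots> = (\<integral>\<^sup>+ z. \<integral>\<^sup>+ b. ?g b * h (\<mu> + V *v z + b) \<partial>leb \<partial>?std)"
  proof (rule nn_integral_cong)
    fix z
    have "(\<integral>\<^sup>+ w. h (\<mu> + V *v z + (\<Sum>u\<in>E. w u *\<^sub>R u)) \<partial>?N) =
       (\<integral>\<^sup>+ b. h (\<mu> + V *v z + b) \<partial>distr ?N borel (\<lambda>w. \<Sum>u\<in>E. w u *\<^sub>R u))"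
      by (subst nn_integral_distr) auto
    also have "\<dots> = (\<integral>\<^sup>+ b. ?g b * h (\<mu> + V *v z + b) \<partial>leb)"
      unfolding distr_PiM_normal_measure[OF orthonormal_E \<sigma>]
      by (subst nn_integral_density) auto
    finally show "(\<integral>\<^sup>+ w. h (\<mu> + V *v z + (\<Sum>u\<in>E. w u *\<^sub>R u)) \<partial>?N) = \<dots>" .
  qed
  also have "\<dots> = (\<integral>\<^sup>+ z. \<integral>\<^sup>+ \<xi>. \<integral>\<^sup>+ b. ennreal (gauss_kernel (real CARD('k) * real (card E)) \<sigma> (sq_sum \<xi>)) *
       (?g b * f (\<mu> + V *v z + b, \<xi>)) \<partial>leb \<partial>obs_leb \<partial>?std)"
  proof (rule nn_integral_cong)
    fix z
    have "(\<integral>\<^sup>+ b. ?g b * h (\<mu> + V *v z + b) \<partial>leb) =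
      (\<integral>\<^sup>+ b. \<integral>\<^sup>+ \<xi>. ennreal (gauss_kernel (real CARD('k) * real (card E)) \<sigma> (sq_sum \<xi>)) *
       (?g b * f (\<mu> + V *v z + b, \<xi>)) \<partial>obs_leb \<partial>leb)"
      unfolding h_def
      by (intro nn_integral_cong)
         (subst nn_integral_density, auto simp: nn_integral_cmult[symmetric] mult_ac)
    also have "\<dots> = (\<integral>\<^sup>+ \<xi>. \<integral>\<^sup>+ b. ennreal (gauss_kernel (real CARD('k) * real (card E)) \<sigma> (sq_sum \<xi>)) *
       (?g b * f (\<mu> + V *v z + b, \<xi>)) \<partial>leb \<partial>obs_leb)"
      by (intro nn_integral_swap sf) measurable
    finally show "(\<integral>\<^sup>+ b. ?g b * h (\<mu> + V *v z + b) \<partial>leb) = \<dots>" .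
  qed
  finally show ?thesis
    unfolding PiM_residual[OF \<sigma>] .
qed

text \<open>By conjugacy, the prior density times the likelihood is the evidence times the posterior density;
  exchanging the order of integration then puts the posterior of \<open>s\<close> innermost.\<close>

lemma posterior_disintegration:
  fixes f :: "real \<times> (real ^ 'n) \<times> ('k::finite \<Rightarrow> real ^ 'n) \<Rightarrow> ennreal" and \<mu> :: "real ^ 'n"
    and s :: "'w \<Rightarrow> real" and x :: "'w \<Rightarrow> real ^ 'n" and Xobs :: "'k \<Rightarrow> 'w \<Rightarrow> real ^ 'n"
  assumes \<alpha>: "\<alpha> > 0" and \<beta>: "\<beta> > 0" and M: "prob_space M"
    and s: "distr M borel s = inv_gamma \<alpha> \<beta>"
    and cond: "regular_cond_dist M
           (borel \<Otimes>\<^sub>M (\<Pi>\<^sub>M j\<in>UNIV. borel)) (\<lambda>\<omega>. (x \<omega>, \<lambda>j. Xobs j \<omega>))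
           (restrict_space borel {0<..}) s
           (\<lambda>\<sigma>. prior \<mu> \<sigma> \<Otimes>\<^sub>M (\<Pi>\<^sub>M j\<in>UNIV. distr (prior \<mu> \<sigma>) borel (\<lambda>v. oblique *v (v - \<mu>))))"
    and f[measurable]: "f \<in> borel_measurable (borel \<Otimes>\<^sub>M borel \<Otimes>\<^sub>M (\<Pi>\<^sub>M j\<in>UNIV. borel))"
  shows "(\<integral>\<^sup>+ \<omega>. f (s \<omega>, x \<omega>, \<lambda>j. Xobs j \<omega>) \<partial>M) =
    (\<integral>\<^sup>+ z. \<integral>\<^sup>+ \<xi>. ennreal (inv_gamma_evidence \<alpha> \<beta> (real CARD('k) * real (card E)) (sq_sum \<xi>)) *
      (\<integral>\<^sup>+ \<sigma>. \<integral>\<^sup>+ b. ennreal (inv_gamma_density (\<alpha> + real CARD('k) * real (card E) / 2) (\<beta> + sq_sum \<xi> / 2) \<sigma>) *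
        (ennreal (gauss_kernel (card E) \<sigma> ((norm b)\<^sup>2)) * f (\<sigma>, \<mu> + V *v z + b, \<xi>))
        \<partial>leb \<partial>lborel) \<partial>obs_leb \<partial>std_gaussian)"
proof -
  let ?p = "real CARD('k) * real (card E)"
  let ?K = "\<lambda>\<sigma>. prior \<mu> \<sigma> \<Otimes>\<^sub>M (\<Pi>\<^sub>M j\<in>(UNIV::'k set). distr (prior \<mu> \<sigma>) borel (\<lambda>v. oblique *v (v - \<mu>)))"
  let ?std = "std_gaussian :: (real ^ 'm) measure"
  let ?g = "\<lambda>\<sigma> b. ennreal (gauss_kernel (card E) \<sigma> ((norm b)\<^sup>2))"
  let ?G = "\<lambda>\<sigma> \<xi>. ennreal (gauss_kernel ?p \<sigma> (sq_sum \<xi>))"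
  let ?F = "\<lambda>\<sigma> z \<xi> b. ennreal (inv_gamma_density \<alpha> \<beta> \<sigma>) * (?G \<sigma> \<xi> * (?g \<sigma> b * f (\<sigma>, \<mu> + V *v z + b, \<xi>)))"
  have std: "sigma_finite_measure ?std" by (intro prob_space_imp_sigma_finite prob_space_std_gaussian)
  interpret leb: sigma_finite_measure leb by (rule sigma_finite_subspace_lebesgue)
  interpret obs: sigma_finite_measure "obs_leb :: ('k \<Rightarrow> _) measure" by (rule sigma_finite_obs_leb)
  interpret std: sigma_finite_measure ?std by (rule std)
  have s_m [measurable]: "s \<in> M \<rightarrow>\<^sub>M restrict_space borel {0<..}"
    using cond by (simp add: regular_cond_dist_def)
  have s_borel [measurable]: "s \<in> borel_measurable M"
    using s_m by (simp add: measurable_restrict_space2_iff)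
  have s_pos: "s \<omega> > 0" if "\<omega> \<in> space M" for \<omega>
    using measurable_space[OF s_m that] by (simp add: space_restrict_space)
  have [measurable]: "(\<lambda>x. x) \<in> restrict_space borel {0<..} \<rightarrow>\<^sub>M (borel :: real measure)"
    by (rule measurable_restrict_space1) simp
  \<comment> \<open>The conditional kernel is specified for positive \<open>\<sigma>\<close> only,
    whereas \<open>H\<close> is an explicit formula, measurable on the whole line. This allows
    passing from \<open>s\<close> to its law.\<close>
  define H where "H = (\<lambda>\<sigma>. \<integral>\<^sup>+ z. \<integral>\<^sup>+ \<xi>. \<integral>\<^sup>+ b. ?G \<sigma> \<xi> * (?g \<sigma> b * f (\<sigma>, \<mu> + V *v z + b, \<xi>)) \<partial>leb \<partial>obs_leb \<partial>?std)"
  have H_m [measurable]: "H \<in> borel_measurable borel"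
    unfolding H_def by measurable
  have "(\<integral>\<^sup>+ \<omega>. f (s \<omega>, x \<omega>, \<lambda>j. Xobs j \<omega>) \<partial>M) = (\<integral>\<^sup>+ \<omega>. \<integral>\<^sup>+ y. f (s \<omega>, y) \<partial>?K (s \<omega>) \<partial>M)"
  proof -
    have "(\<lambda>(y, \<sigma>). f (\<sigma>, y)) \<in> borel_measurable ((borel \<Otimes>\<^sub>M (\<Pi>\<^sub>M j\<in>UNIV. borel)) \<Otimes>\<^sub>M restrict_space borel {0<..})"
      by measurable
    from regular_cond_dist_nn_integral[OF M cond this] show ?thesis by simp
  qed
  also have "\<dots> = (\<integral>\<^sup>+ \<omega>. H (s \<omega>) \<partial>M)"
    unfolding H_def by (intro nn_integral_cong nn_integral_likelihood s_pos) auto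
  also have "\<dots> = (\<integral>\<^sup>+ \<sigma>. H \<sigma> \<partial>inv_gamma \<alpha> \<beta>)"
    unfolding s[symmetric] by (subst nn_integral_distr) auto
  also have "\<dots> = (\<integral>\<^sup>+ \<sigma>. ennreal (inv_gamma_density \<alpha> \<beta> \<sigma>) * H \<sigma> \<partial>lborel)"
    unfolding inv_gamma_eq by (subst nn_integral_density) auto
  also have "\<dots> = (\<integral>\<^sup>+ \<sigma>. \<integral>\<^sup>+ z. \<integral>\<^sup>+ \<xi>. \<integral>\<^sup>+ b. ?F \<sigma> z \<xi> b \<partial>leb \<partial>obs_leb \<partial>?std \<partial>lborel)"
    unfolding H_def
    by (intro nn_integral_cong trans[OF nn_integral_cmult[symmetric]])
       (measurable, auto simp: space_PiM)
  also have "\<dots> = (\<integral>\<^sup>+ z. \<integral>\<^sup>+ \<sigma>. \<integral>\<^sup>+ \<xi>. \<integral>\<^sup>+ b. ?F \<sigma> z \<xi> b \<partial>leb \<partial>obs_leb \<partial>lborel \<partial>?std)"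
    by (intro nn_integral_swap std sigma_finite_lborel) measurable
  also have "\<dots> = (\<integral>\<^sup>+ z. \<integral>\<^sup>+ \<xi>. \<integral>\<^sup>+ \<sigma>. \<integral>\<^sup>+ b. ?F \<sigma> z \<xi> b \<partial>leb \<partial>lborel \<partial>obs_leb \<partial>?std)"
    by (intro nn_integral_cong nn_integral_swap sigma_finite_obs_leb sigma_finite_lborel) measurable
  also have "\<dots> = (\<integral>\<^sup>+ z. \<integral>\<^sup>+ \<xi>. ennreal (inv_gamma_evidence \<alpha> \<beta> ?p (sq_sum \<xi>)) *
      (\<integral>\<^sup>+ \<sigma>. \<integral>\<^sup>+ b. ennreal (inv_gamma_density (\<alpha> + ?p / 2) (\<beta> + sq_sum \<xi> / 2) \<sigma>) *
        (?g \<sigma> b * f (\<sigma>, \<mu> + V *v z + b, \<xi>)) \<partial>leb \<partial>lborel) \<partial>obs_leb \<partial>std_gaussian)"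
  proof (intro nn_integral_cong)
    fix z and \<xi> :: "'k \<Rightarrow> real ^ 'n"
    have q: "sq_sum \<xi> \<ge> 0" by (simp add: sq_sum_def sum_nonneg)
    have [simp]: "\<xi> \<in> space (\<Pi>\<^sub>M j\<in>UNIV. borel)" by (simp add: space_PiM)
    define e where "e = ennreal (inv_gamma_evidence \<alpha> \<beta> ?p (sq_sum \<xi>))"
    define k where "k = (\<lambda>\<sigma> b. ennreal (inv_gamma_density (\<alpha> + ?p / 2) (\<beta> + sq_sum \<xi> / 2) \<sigma>) *
        (?g \<sigma> b * f (\<sigma>, \<mu> + V *v z + b, \<xi>)))"
    have [measurable]: "(\<lambda>(\<sigma>, b). k \<sigma> b) \<in> borel_measurable (lborel \<Otimes>\<^sub>M leb)"
      unfolding k_def by measurable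
    \<comment> \<open>For \<open>\<sigma> \<le> 0\<close> both inverse-gamma densities vanish, so
      the identity holds on the whole line.\<close>
    have eq: "?F \<sigma> z \<xi> b = e * k \<sigma> b" for \<sigma> b
    proof -
      have "ennreal (inv_gamma_density \<alpha> \<beta> \<sigma>) * ?G \<sigma> \<xi> = ennreal (inv_gamma_evidence \<alpha> \<beta> ?p (sq_sum \<xi>)) *
          ennreal (inv_gamma_density (\<alpha> + ?p / 2) (\<beta> + sq_sum \<xi> / 2) \<sigma>)"
        using inv_gamma_density_conjugate[OF \<alpha> \<beta> _ q, of ?p \<sigma>] \<alpha>
        by (simp add: gauss_kernel_def inv_gamma_density_nonneg inv_gamma_evidence_nonneg add_pos_nonneg flip: ennreal_mult)
      then show ?thesis by (simp add: e_def k_def mult.assoc[symmetric])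
    qed
    have "(\<integral>\<^sup>+ \<sigma>. \<integral>\<^sup>+ b. ?F \<sigma> z \<xi> b \<partial>leb \<partial>lborel) = (\<integral>\<^sup>+ \<sigma>. e * (\<integral>\<^sup>+ b. k \<sigma> b \<partial>leb) \<partial>lborel)"
      unfolding eq by (intro nn_integral_cong nn_integral_cmult) measurable
    also have "\<dots> = e * (\<integral>\<^sup>+ \<sigma>. \<integral>\<^sup>+ b. k \<sigma> b \<partial>leb \<partial>lborel)"
      by (rule nn_integral_cmult) measurable
    finally show "(\<integral>\<^sup>+ \<sigma>. \<integral>\<^sup>+ b. ?F \<sigma> z \<xi> b \<partial>leb \<partial>lborel) =
      ennreal (inv_gamma_evidence \<alpha> \<beta> ?p (sq_sum \<xi>)) *
      (\<integral>\<^sup>+ \<sigma>. \<integral>\<^sup>+ b. ennreal (inv_gamma_density (\<alpha> + ?p / 2) (\<beta> + sq_sum \<xi> / 2) \<sigma>) *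
        (?g \<sigma> b * f (\<sigma>, \<mu> + V *v z + b, \<xi>)) \<partial>leb \<partial>lborel)"
      unfolding e_def k_def .
  qed
  finally show ?thesis .
qed

text \<open>By conjugacy with \<open>p = card E\<close>, integrating out \<open>\<sigma>\<close>
  leaves the evidence at the squared norm of \<open>b\<close>, since the updated inverse-gamma
  density has mass one. With \<open>2 * a\<close> degrees of freedom and scale \<open>c / a\<close>
  this evidence is the Student density.\<close>

lemma nn_integral_student_mixture:
  fixes f :: "real ^ 'n \<Rightarrow> ennreal"
  assumes a: "a > 0" and c: "c > 0" and f[measurable]: "f \<in> borel_measurable borel"
  shows "(\<integral>\<^sup>+ v. f v \<partial>student (2 * a) \<mu> ((c / a) *\<^sub>R P)) =
    (\<integral>\<^sup>+ \<sigma>. \<integral>\<^sup>+ b. ennreal (inv_gamma_density a c \<sigma>) *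
        (ennreal (gauss_kernel (card E) \<sigma> ((norm b)\<^sup>2)) * f (\<mu> + b)) \<partial>leb \<partial>lborel)"
proof -
  have ca: "c / a > 0" using a c by simp
  obtain E' where E': "is_projection P E'" "span E' = span E" and st:
    "student (2 * a) \<mu> ((c / a) *\<^sub>R P) = density (distr (\<Pi>\<^sub>M u\<in>E'. lborel) borel (\<lambda>y. \<mu> + (\<Sum>u\<in>E'. y u *\<^sub>R u)))
       (\<lambda>x. ennreal (Gamma ((2 * a + card E') / 2) / (Gamma (2 * a / 2) * sqrt ((pi * (2 * a) * (c / a)) ^ card E'))
         * (1 + 1 / (2 * a) * ((x - \<mu>) \<bullet> (P *v (x - \<mu>)) / (c / a))) powr (- (2 * a + card E') / 2)))"
    by (rule student_scaled_projection[OF proj ca])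
  have o: "orthonormal E'" using E' by (simp add: is_projection_def)
  have card: "card E' = card E"
    using E'(2) orthonormal_independent[OF o] orthonormal_independent[OF orthonormal_E]
    by (metis dim_eq_card_independent dim_span)
  define d where "d = (\<lambda>q. inv_gamma_evidence a c (card E) q)"
  have [measurable]: "d \<in> borel_measurable borel"
    unfolding d_def inv_gamma_evidence_def by measurable
  \<comment> \<open>Degrees of freedom times scale is \<open>2 * c\<close>, so the normalisation
    contains \<open>2 * pi * c\<close> and the base of the power is \<open>(c + q / 2) / c\<close>.
    Of the numerator \<open>c powr (a + card E / 2)\<close> the factor
    \<open>c powr (card E / 2)\<close> cancels against the normalisation.\<close>
  have dens: "Gamma ((2 * a + card E) / 2) / (Gamma (2 * a / 2) * sqrt ((pi * (2 * a) * (c / a)) ^ card E))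
         * (1 + 1 / (2 * a) * (q / (c / a))) powr (- (2 * a + card E) / 2) = d q" if q: "q \<ge> 0" for q
  proof -
    let ?l = "real (card E)"
    have 1: "pi * (2 * a) * (c / a) = 2 * pi * c" using a by simp
    have 2: "sqrt ((2 * pi * c) ^ card E) = (2 * pi) powr (?l / 2) * c powr (?l / 2)"
      using c by (simp add: powr_half_sqrt[symmetric] powr_powr powr_mult flip: powr_realpow)
    have 3: "1 + 1 / (2 * a) * (q / (c / a)) = (c + q / 2) / c" using a c by (simp add: field_simps)
    have 4: "((c + q / 2) / c) powr (- (2 * a + ?l) / 2) = c powr (a + ?l / 2) / (c + q / 2) powr (a + ?l / 2)"
    proof -
      have "((c + q / 2) / c) powr - e = c powr e / (c + q / 2) powr e" for e
        using c q by (simp add: powr_minus_divide powr_divide)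
      moreover have "- (2 * a + ?l) / 2 = - (a + ?l / 2)" by (simp add: field_simps)
      ultimately show ?thesis by metis
    qed
    have 5: "c powr (a + ?l / 2) = c powr a * c powr (?l / 2)" by (simp add: powr_add)
    have 6: "(2 * a + ?l) / 2 = a + ?l / 2" by simp
    have 7: "c powr (?l / 2) \<noteq> 0" using c by simp
    show ?thesis
      unfolding 1 2 3 4 5 6 d_def inv_gamma_evidence_def using 7 by simp
  qed
  let ?S = "\<lambda>y. \<Sum>u\<in>E'. y u *\<^sub>R u"
  have S: "?S y \<bullet> (P *v ?S y) = (norm (?S y))\<^sup>2" for y
  proof -
    have "?S y \<in> span E'" by (auto intro: span_sum[OF span_mul[OF span_base]])
    then show ?thesis using is_projection_fixes[OF E'(1)] by (simp add: power2_norm_eq_inner)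
  qed
  have "(\<integral>\<^sup>+ v. f v \<partial>student (2 * a) \<mu> ((c / a) *\<^sub>R P)) =
      (\<integral>\<^sup>+ y. ennreal (d ((norm (?S y))\<^sup>2)) * f (\<mu> + ?S y) \<partial>(\<Pi>\<^sub>M u\<in>E'. lborel))"
    unfolding st
    by (subst nn_integral_density, measurable, subst nn_integral_distr, measurable)
       (simp only: add_diff_cancel_left' S card dens zero_le_power2)
  also have "\<dots> = (\<integral>\<^sup>+ b. ennreal (d ((norm b)\<^sup>2)) * f (\<mu> + b) \<partial>subspace_lebesgue E')"
    unfolding subspace_lebesgue_def by (subst nn_integral_distr) auto
  also have "\<dots> = (\<integral>\<^sup>+ b. ennreal (d ((norm b)\<^sup>2)) * f (\<mu> + b) \<partial>leb)"
    by (simp add: subspace_lebesgue_basis[OF E'])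
  also have "\<dots> = (\<integral>\<^sup>+ b. \<integral>\<^sup>+ \<sigma>. ennreal (inv_gamma_density a c \<sigma>) *
        (ennreal (gauss_kernel (card E) \<sigma> ((norm b)\<^sup>2)) * f (\<mu> + b)) \<partial>lborel \<partial>leb)"
  proof (rule nn_integral_cong)
    fix b :: "real ^ 'n"
    let ?q = "(norm b)\<^sup>2" and ?l = "real (card E)"
    have "ennreal (inv_gamma_density a c \<sigma>) * (ennreal (gauss_kernel ?l \<sigma> ?q) * f (\<mu> + b)) =
        ennreal (d ?q) * f (\<mu> + b) * ennreal (inv_gamma_density (a + ?l / 2) (c + ?q / 2) \<sigma>)" for \<sigma>
    proof -
      have "ennreal (inv_gamma_density a c \<sigma>) * ennreal (gauss_kernel ?l \<sigma> ?q) =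
          ennreal (d ?q) * ennreal (inv_gamma_density (a + ?l / 2) (c + ?q / 2) \<sigma>)"
        using inv_gamma_density_conjugate[OF a c, of ?l ?q \<sigma>] a
        by (simp add: d_def gauss_kernel_def inv_gamma_density_nonneg inv_gamma_evidence_nonneg add_pos_nonneg flip: ennreal_mult)
      then show ?thesis by (simp add: mult.assoc[symmetric]) (simp add: mult_ac)
    qed
    then show "ennreal (d ?q) * f (\<mu> + b) = (\<integral>\<^sup>+ \<sigma>. ennreal (inv_gamma_density a c \<sigma>) *
        (ennreal (gauss_kernel ?l \<sigma> ?q) * f (\<mu> + b)) \<partial>lborel)"
      using a c by (simp add: nn_integral_cmult nn_integral_inv_gamma_density add_pos_nonneg)
  qed
  also have "\<dots> = (\<integral>\<^sup>+ \<sigma>. \<integral>\<^sup>+ b. ennreal (inv_gamma_density a c \<sigma>) *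
        (ennreal (gauss_kernel (card E) \<sigma> ((norm b)\<^sup>2)) * f (\<mu> + b)) \<partial>leb \<partial>lborel)"
    by (intro nn_integral_swap sigma_finite_subspace_lebesgue sigma_finite_lborel) measurable
  finally show ?thesis .
qed

end

section \<open>Posterior and predictive distributions\<close>

definition matrix_of_columns :: "('k \<Rightarrow> real ^ 'n) \<Rightarrow> real ^ 'k ^ 'n" where
  "matrix_of_columns \<xi> = (\<chi> i j. \<xi> j $ i)"

lemma measurable_matrix_of_columns [measurable]:
  "matrix_of_columns \<in> borel_measurable (\<Pi>\<^sub>M j\<in>(UNIV :: 'k::finite set). borel)"
  unfolding matrix_of_columns_def by measurable

lemma trace_matrix_of_columns:
  "trace (transpose (matrix_of_columns \<xi>) ** matrix_of_columns \<xi>) = (\<Sum>j\<in>UNIV. (norm (\<xi> j))\<^sup>2)"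
  by (simp add: matrix_of_columns_def trace_def transpose_def matrix_matrix_mult_def
      power2_norm_eq_inner inner_vec_def)

lemma trace_gram_nonneg: "trace (transpose \<zeta> ** \<zeta>) \<ge> 0" for \<zeta> :: "real ^ 'k ^ 'n"
  by (auto simp: trace_def transpose_def matrix_matrix_mult_def intro!: sum_nonneg)

lemma measurable_trace_gram [measurable]:
  "(\<lambda>\<zeta>. trace (transpose \<zeta> ** \<zeta>)) \<in> borel_measurable (borel :: (real ^ 'k ^ 'n) measure)"
  unfolding trace_def transpose_def matrix_matrix_mult_def by simp

lemma measurable_inv_gamma:
  assumes "\<alpha> > 0" "\<And>x. x \<in> space N \<Longrightarrow> b x > 0" and [measurable]: "b \<in> borel_measurable N"
  shows "(\<lambda>x. inv_gamma \<alpha> (b x)) \<in> N \<rightarrow>\<^sub>M prob_algebra borel"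
proof (intro measurable_prob_algebraI measurable_subprob_algebra)
  fix x assume "x \<in> space N"
  then show "prob_space (inv_gamma \<alpha> (b x))" using assms by (simp add: prob_space_inv_gamma)
  then show "subprob_space (inv_gamma \<alpha> (b x))" by (rule prob_space_imp_subprob_space)
next
  fix A :: "real set" assume [measurable]: "A \<in> sets borel"
  have "(\<lambda>x. \<integral>\<^sup>+ \<sigma>. ennreal (inv_gamma_density \<alpha> (b x) \<sigma>) * indicator A \<sigma> \<partial>lborel) \<in> borel_measurable N"
    by measurable
  then show "(\<lambda>x. emeasure (inv_gamma \<alpha> (b x)) A) \<in> borel_measurable N"
    by (simp add: inv_gamma_eq emeasure_density)
qed simp

lemma sets_student [simp]: "sets (student \<nu> \<mu> \<Sigma>) = sets borel"
  by (simp add: student_def Let_def case_prod_unfold)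

context conditioned_model
begin

text \<open>Conditioning on \<open>L *v x\<close> needs this: \<open>L\<close> is known to be
  constant on \<open>\<mu> + V *v z + b\<close> only while \<open>b\<close> stays in
  \<open>span E\<close>.\<close>

lemma AE_subspace_lebesgue: "AE b in leb. b \<in> span E"
proof -
  have [measurable]: "span E \<in> sets borel" by (simp add: closed_subspace)
  show ?thesis
    unfolding subspace_lebesgue_def
    by (subst AE_distr_iff) (auto intro: span_sum[OF span_mul[OF span_base]])
qed

lemma nn_integral_residual: "\<sigma> > 0 \<Longrightarrow> (\<integral>\<^sup>+ b. ennreal (gauss_kernel (card E) \<sigma> ((norm b)\<^sup>2)) \<partial>leb) = 1"
  using prob_space.emeasure_space_1[OF prob_space_residual[of \<sigma>]] by (simp add: emeasure_density)

text \<open>The factor \<open>h\<close> ignores \<open>b\<close>, so for positive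
  \<open>\<sigma>\<close> the Gaussian kernel integrates to one; elsewhere the inverse-gamma density
  vanishes.\<close>

lemma nn_integral_mixture:
  assumes [measurable]: "h \<in> borel_measurable borel"
  shows "(\<integral>\<^sup>+ \<sigma>. \<integral>\<^sup>+ b. ennreal (inv_gamma_density a c \<sigma>) *
      (ennreal (gauss_kernel (card E) \<sigma> ((norm b)\<^sup>2)) * h \<sigma>) \<partial>leb \<partial>lborel) =
    (\<integral>\<^sup>+ \<sigma>. h \<sigma> \<partial>inv_gamma a c)"
proof -
  have "(\<integral>\<^sup>+ b. ennreal (inv_gamma_density a c \<sigma>) * (ennreal (gauss_kernel (card E) \<sigma> ((norm b)\<^sup>2)) * h \<sigma>) \<partial>leb) =
      ennreal (inv_gamma_density a c \<sigma>) * h \<sigma>" for \<sigma>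
  proof (cases "\<sigma> > 0")
    case True
    then show ?thesis by (simp add: nn_integral_cmult nn_integral_multc nn_integral_residual)
  qed (simp add: inv_gamma_density_def)
  then show ?thesis unfolding inv_gamma_eq by (subst nn_integral_density) auto
qed

section \<open>The Student distribution as a probability kernel\<close>

lemma prob_space_student:
  assumes a: "a > 0" and c: "c > 0"
  shows "prob_space (student (2 * a) \<mu> ((c / a) *\<^sub>R P))"
proof (rule prob_spaceI)
  let ?S = "student (2 * a) \<mu> ((c / a) *\<^sub>R P)"
  have "emeasure ?S (space ?S) = (\<integral>\<^sup>+ v. 1 \<partial>?S)" by simp
  also have "\<dots> = (\<integral>\<^sup>+ \<sigma>. 1 \<partial>inv_gamma a c)"
    by (subst nn_integral_student_mixture[OF a c], simp, subst nn_integral_mixture) auto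
  also have "\<dots> = 1"
    using prob_space.emeasure_space_1[OF prob_space_inv_gamma[OF a c]] by simp
  finally show "emeasure ?S (space ?S) = 1" .
qed

text \<open>The basis chosen inside \<open>student\<close> may change with \<open>c x\<close>, so
  measurability cannot be read off the definition. The mixture formula replaces it by integrals over
  fixed base measures.\<close>

lemma measurable_student:
  assumes a: "a > 0" and c: "\<And>x. x \<in> space N \<Longrightarrow> c x > 0"
    and [measurable]: "c \<in> borel_measurable N" "m \<in> borel_measurable N"
  shows "(\<lambda>x. student (2 * a) (m x) ((c x / a) *\<^sub>R P)) \<in> N \<rightarrow>\<^sub>M prob_algebra borel"
proof (intro measurable_prob_algebraI measurable_subprob_algebra)
  fix x assume "x \<in> space N"
  then show "prob_space (student (2 * a) (m x) ((c x / a) *\<^sub>R P))" using prob_space_student[OF a c] by simp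
  then show "subprob_space (student (2 * a) (m x) ((c x / a) *\<^sub>R P))" by (rule prob_space_imp_subprob_space)
next
  fix A :: "(real ^ 'n) set" assume [measurable]: "A \<in> sets borel"
  interpret sigma_finite_measure leb by (rule sigma_finite_subspace_lebesgue)
  have "(\<lambda>x. \<integral>\<^sup>+ \<sigma>. \<integral>\<^sup>+ b. ennreal (inv_gamma_density a (c x) \<sigma>) *
        (ennreal (gauss_kernel (card E) \<sigma> ((norm b)\<^sup>2)) * indicator A (m x + b)) \<partial>leb \<partial>lborel) \<in> borel_measurable N"
    by measurable
  moreover have "emeasure (student (2 * a) (m x) ((c x / a) *\<^sub>R P)) A =
      (\<integral>\<^sup>+ \<sigma>. \<integral>\<^sup>+ b. ennreal (inv_gamma_density a (c x) \<sigma>) *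
        (ennreal (gauss_kernel (card E) \<sigma> ((norm b)\<^sup>2)) * indicator A (m x + b)) \<partial>leb \<partial>lborel)"
    if "x \<in> space N" for x
    using nn_integral_student_mixture[OF a c[OF that], of "indicator A" "m x"] by simp
  ultimately show "(\<lambda>x. emeasure (student (2 * a) (m x) ((c x / a) *\<^sub>R P)) A) \<in> borel_measurable N"
    by (simp cong: measurable_cong)
qed simp

text \<open>Each claim equates the integrals of two functions of \<open>s\<close>, \<open>x\<close>
  and the observations: the indicator of an event, and the proposed kernel evaluated at the
  conditioning variable. After disintegration it suffices that their inner integrals agree for every
  \<open>z\<close> and every value of the observations; in the predictive case this works because
  \<open>L *v x\<close> determines \<open>z\<close>.\<close>

lemma posterior_and_predictive:
  fixes \<mu> :: "real ^ 'n" and M :: "'w measure"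
    and s :: "'w \<Rightarrow> real" and x :: "'w \<Rightarrow> real ^ 'n" and Xobs :: "'k::finite \<Rightarrow> 'w \<Rightarrow> real ^ 'n"
  defines "a \<equiv> \<lambda>\<alpha>. \<alpha> + real CARD('k) * real (card E) / 2"
  defines "c \<equiv> \<lambda>\<beta> (\<zeta> :: real ^ 'k ^ 'n). \<beta> + trace (transpose \<zeta> ** \<zeta>) / 2"
  defines "X \<equiv> \<lambda>\<omega>. matrix_of_columns (\<lambda>j. Xobs j \<omega>)"
  assumes \<alpha>: "\<alpha> > 0" and \<beta>: "\<beta> > 0" and M: "prob_space M"
    and s: "distr M borel s = inv_gamma \<alpha> \<beta>"
    and cond: "regular_cond_dist M
           (borel \<Otimes>\<^sub>M (\<Pi>\<^sub>M j\<in>UNIV. borel)) (\<lambda>\<omega>. (x \<omega>, \<lambda>j. Xobs j \<omega>))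
           (restrict_space borel {0<..}) s
           (\<lambda>\<sigma>. prior \<mu> \<sigma> \<Otimes>\<^sub>M (\<Pi>\<^sub>M j\<in>UNIV. distr (prior \<mu> \<sigma>) borel (\<lambda>v. oblique *v (v - \<mu>))))"
  shows "regular_cond_dist M borel s borel X (\<lambda>\<zeta>. inv_gamma (a \<alpha>) (c \<beta> \<zeta>))"
    and "regular_cond_dist M borel x (borel \<Otimes>\<^sub>M borel) (\<lambda>\<omega>. (L *v x \<omega>, X \<omega>))
      (\<lambda>(d, \<zeta>). student (2 * a \<alpha>) (\<mu> + V *v (matrix_inv (L ** V) *v (d - L *v \<mu>))) ((c \<beta> \<zeta> / a \<alpha>) *\<^sub>R P))"
proof -
  let ?p = "real CARD('k) * real (card E)"
  define ev where "ev = (\<lambda>\<xi> :: 'k \<Rightarrow> real ^ 'n. ennreal (inv_gamma_evidence \<alpha> \<beta> ?p (sq_sum \<xi>)))"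
  define inner where "inner = (\<lambda>f z \<xi>. \<integral>\<^sup>+ \<sigma>. \<integral>\<^sup>+ b. ennreal (inv_gamma_density (a \<alpha>) (c \<beta> (matrix_of_columns \<xi>)) \<sigma>) *
        (ennreal (gauss_kernel (card E) \<sigma> ((norm b)\<^sup>2)) * f (\<sigma>, \<mu> + V *v z + b, \<xi>)) \<partial>leb \<partial>lborel)"
  have disint: "(\<integral>\<^sup>+ \<omega>. f (s \<omega>, x \<omega>, \<lambda>j. Xobs j \<omega>) \<partial>M) = (\<integral>\<^sup>+ z. \<integral>\<^sup>+ \<xi>. ev \<xi> * inner f z \<xi> \<partial>obs_leb \<partial>std_gaussian)"
    if "f \<in> borel_measurable (borel \<Otimes>\<^sub>M borel \<Otimes>\<^sub>M (\<Pi>\<^sub>M j\<in>UNIV. borel))" for f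
    using posterior_disintegration[OF \<alpha> \<beta> M s cond that]
    by (simp add: ev_def inner_def a_def c_def trace_matrix_of_columns sq_sum_def)
  have a_pos: "a \<alpha> > 0" using \<alpha> by (simp add: a_def add_pos_nonneg)
  have c_pos: "c \<beta> \<zeta> > 0" for \<zeta> using \<beta> trace_gram_nonneg[of \<zeta>] by (simp add: c_def)
  have [measurable]: "c \<beta> \<in> borel_measurable borel" unfolding c_def by measurable
  have xX: "(\<lambda>\<omega>. (x \<omega>, \<lambda>j. Xobs j \<omega>)) \<in> M \<rightarrow>\<^sub>M borel \<Otimes>\<^sub>M (\<Pi>\<^sub>M j\<in>UNIV. borel)"
    and s_m: "s \<in> M \<rightarrow>\<^sub>M restrict_space borel {0<..}"
    using cond by (simp_all add: regular_cond_dist_def)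
  have [measurable]: "s \<in> borel_measurable M"
    using s_m by (simp add: measurable_restrict_space2_iff)
  have [measurable]: "x \<in> borel_measurable M"
    using measurable_compose[OF xX measurable_fst] by simp
  have [measurable]: "(\<lambda>\<omega>. (\<lambda>j. Xobs j \<omega>)) \<in> M \<rightarrow>\<^sub>M (\<Pi>\<^sub>M j\<in>UNIV. borel)"
    using measurable_compose[OF xX measurable_snd] by simp
  have X_m [measurable]: "X \<in> borel_measurable M"
    unfolding X_def by measurable
  \<comment> \<open>For fixed \<open>z\<close> and \<open>\<xi>\<close>, \<open>inner\<close>
    integrates against a probability measure, so a function of the observations alone comes out
    unchanged.\<close>
  have inner_const: "inner (\<lambda>(\<sigma>, v, \<xi>). h \<xi>) z \<xi> = h \<xi>" for h z \<xi>
    unfolding inner_def using nn_integral_mixture[of "\<lambda>_. h \<xi>" "a \<alpha>" "c \<beta> (matrix_of_columns \<xi>)"]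
      prob_space.emeasure_space_1[OF prob_space_inv_gamma[OF a_pos c_pos]] by simp

  show "regular_cond_dist M borel s borel X (\<lambda>\<zeta>. inv_gamma (a \<alpha>) (c \<beta> \<zeta>))"
    unfolding regular_cond_dist_def
  proof (intro conjI ballI)
    show K: "(\<lambda>\<zeta>. inv_gamma (a \<alpha>) (c \<beta> \<zeta>)) \<in> borel \<rightarrow>\<^sub>M prob_algebra borel"
      by (intro measurable_inv_gamma a_pos c_pos) measurable
    note [measurable] = measurable_prob_algebraD[OF K]
    fix A :: "real set" and B :: "(real ^ 'k ^ 'n) set"
    assume [measurable]: "A \<in> sets borel" "B \<in> sets borel"
    have em [measurable]: "(\<lambda>\<zeta>. emeasure (inv_gamma (a \<alpha>) (c \<beta> \<zeta>)) A) \<in> borel_measurable borel"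
      by measurable
    let ?f1 = "\<lambda>(\<sigma>, v, \<xi>). indicator A \<sigma> * indicator B (matrix_of_columns \<xi>) :: ennreal"
    let ?f2 = "\<lambda>(\<sigma>::real, v::real ^ 'n, \<xi>). emeasure (inv_gamma (a \<alpha>) (c \<beta> (matrix_of_columns \<xi>))) A *
        indicator B (matrix_of_columns \<xi>)"
    have "emeasure M {\<omega> \<in> space M. s \<omega> \<in> A \<and> X \<omega> \<in> B} =
        (\<integral>\<^sup>+ \<omega>. indicator {\<omega> \<in> space M. s \<omega> \<in> A \<and> X \<omega> \<in> B} \<omega> \<partial>M)"
      by (rule nn_integral_indicator[symmetric]) measurable
    also have "\<dots> = (\<integral>\<^sup>+ \<omega>. ?f1 (s \<omega>, x \<omega>, \<lambda>j. Xobs j \<omega>) \<partial>M)"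
      by (intro nn_integral_cong) (auto simp: X_def split: split_indicator)
    also have "\<dots> = (\<integral>\<^sup>+ z. \<integral>\<^sup>+ \<xi>. ev \<xi> * inner ?f1 z \<xi> \<partial>obs_leb \<partial>std_gaussian)"
      by (rule disint) measurable
    also have "\<dots> = (\<integral>\<^sup>+ z. \<integral>\<^sup>+ \<xi>. ev \<xi> * inner ?f2 z \<xi> \<partial>obs_leb \<partial>std_gaussian)"
    proof -
      have "inner ?f1 z \<xi> = inner ?f2 z \<xi>" for z \<xi>
      proof -
        have "inner ?f1 z \<xi> = (\<integral>\<^sup>+ \<sigma>. indicator A \<sigma> * indicator B (matrix_of_columns \<xi>)
            \<partial>inv_gamma (a \<alpha>) (c \<beta> (matrix_of_columns \<xi>)))"
          unfolding inner_def prod.case by (rule nn_integral_mixture) measurable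
        also have "\<dots> = emeasure (inv_gamma (a \<alpha>) (c \<beta> (matrix_of_columns \<xi>))) A * indicator B (matrix_of_columns \<xi>)"
          by (simp add: nn_integral_multc)
        also have "\<dots> = inner ?f2 z \<xi>" by (rule inner_const[symmetric])
        finally show ?thesis .
      qed
      then show ?thesis by simp
    qed
    also have "\<dots> = (\<integral>\<^sup>+ \<omega>. ?f2 (s \<omega>, x \<omega>, \<lambda>j. Xobs j \<omega>) \<partial>M)"
      by (rule disint[symmetric]) measurable
    finally show "emeasure M {\<omega> \<in> space M. s \<omega> \<in> A \<and> X \<omega> \<in> B} =
        (\<integral>\<^sup>+ \<omega>. emeasure (inv_gamma (a \<alpha>) (c \<beta> (X \<omega>))) A * indicator B (X \<omega>) \<partial>M)"
      by (simp add: X_def)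
  qed measurable

  let ?Q = "\<lambda>(d, \<zeta>). student (2 * a \<alpha>) (\<mu> + V *v (matrix_inv (L ** V) *v (d - L *v \<mu>))) ((c \<beta> \<zeta> / a \<alpha>) *\<^sub>R P)"
  show "regular_cond_dist M borel x (borel \<Otimes>\<^sub>M borel) (\<lambda>\<omega>. (L *v x \<omega>, X \<omega>)) ?Q"
    unfolding regular_cond_dist_def
  proof (intro conjI ballI)
    have "(\<lambda>y. student (2 * a \<alpha>) (\<mu> + V *v (matrix_inv (L ** V) *v (fst y - L *v \<mu>))) ((c \<beta> (snd y) / a \<alpha>) *\<^sub>R P))
        \<in> borel \<Otimes>\<^sub>M borel \<rightarrow>\<^sub>M prob_algebra borel"
      by (intro measurable_student a_pos c_pos) measurable
    then show K: "?Q \<in> borel \<Otimes>\<^sub>M borel \<rightarrow>\<^sub>M prob_algebra borel"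
      by (simp add: case_prod_unfold)
    note [measurable] = measurable_prob_algebraD[OF K]
    fix A :: "(real ^ 'n) set" and B :: "((real ^ 'm) \<times> (real ^ 'k ^ 'n)) set"
    assume [measurable]: "A \<in> sets borel" and B [measurable]: "B \<in> sets (borel \<Otimes>\<^sub>M borel)"
    have [measurable]: "(\<lambda>y. emeasure (?Q y) A) \<in> borel_measurable (borel \<Otimes>\<^sub>M borel)"
      by measurable
    let ?f1 = "\<lambda>(\<sigma>::real, v, \<xi>). indicator A v * indicator B (L *v v, matrix_of_columns \<xi>) :: ennreal"
    let ?f2 = "\<lambda>(\<sigma>::real, v, \<xi>). emeasure (?Q (L *v v, matrix_of_columns \<xi>)) A *
        indicator B (L *v v, matrix_of_columns \<xi>)"
    have "emeasure M {\<omega> \<in> space M. x \<omega> \<in> A \<and> (L *v x \<omega>, X \<omega>) \<in> B} =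
        (\<integral>\<^sup>+ \<omega>. indicator {\<omega> \<in> space M. x \<omega> \<in> A \<and> (L *v x \<omega>, X \<omega>) \<in> B} \<omega> \<partial>M)"
      by (rule nn_integral_indicator[symmetric]) measurable
    also have "\<dots> = (\<integral>\<^sup>+ \<omega>. ?f1 (s \<omega>, x \<omega>, \<lambda>j. Xobs j \<omega>) \<partial>M)"
      by (intro nn_integral_cong) (auto simp: X_def split: split_indicator)
    also have "\<dots> = (\<integral>\<^sup>+ z. \<integral>\<^sup>+ \<xi>. ev \<xi> * inner ?f1 z \<xi> \<partial>obs_leb \<partial>std_gaussian)"
      by (rule disint) measurable
    also have "\<dots> = (\<integral>\<^sup>+ z. \<integral>\<^sup>+ \<xi>. ev \<xi> * inner ?f2 z \<xi> \<partial>obs_leb \<partial>std_gaussian)"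
    proof -
      have "inner ?f1 z \<xi> = inner ?f2 z \<xi>" for z \<xi>
      proof -
        define \<zeta> where "\<zeta> = matrix_of_columns \<xi>"
        \<comment> \<open>The value of \<open>L *v x\<close> shared by all residuals
          \<open>b\<close> in \<open>span E\<close>; at this value the proposed Student law has
          location \<open>\<mu> + V *v z\<close>.\<close>
        define d where "d = L *v (\<mu> + V *v z)"
        have Lb: "L *v (\<mu> + V *v z + b) = d" if "b \<in> span E" for b
          using L_span[OF that] by (simp add: d_def matrix_vector_right_distrib)
        have Qd: "?Q (d, \<zeta>) = student (2 * a \<alpha>) (\<mu> + V *v z) ((c \<beta> \<zeta> / a \<alpha>) *\<^sub>R P)"
        proof -
          have "matrix_inv (L ** V) *v (d - L *v \<mu>) = (matrix_inv (L ** V) ** (L ** V)) *v z"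
            by (simp add: d_def matrix_vector_right_distrib matrix_vector_mul_assoc)
          then show ?thesis by (simp add: matrix_inv_inverse[OF LV])
        qed
        have "inner ?f1 z \<xi> = inner (\<lambda>(\<sigma>, v, \<xi>). indicator A v * indicator B (d, \<zeta>)) z \<xi>"
          unfolding inner_def prod.case
          by (intro nn_integral_cong nn_integral_cong_AE eventually_mono[OF AE_subspace_lebesgue])
             (simp add: Lb \<zeta>_def)
        also have "\<dots> = (\<integral>\<^sup>+ v. indicator A v * indicator B (d, \<zeta>) \<partial>?Q (d, \<zeta>))"
          unfolding Qd unfolding inner_def prod.case \<zeta>_def[symmetric]
          by (subst nn_integral_student_mixture[OF a_pos c_pos]) simp_all
        also have "\<dots> = emeasure (?Q (d, \<zeta>)) A * indicator B (d, \<zeta>)"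
          unfolding Qd by (subst nn_integral_multc) (auto intro!: borel_measurable_indicator)
        \<comment> \<open>On the way back the kernel value is constant for the inner integral, and
          \<open>d\<close> is replaced by \<open>L *v v\<close> almost everywhere.\<close>
        also have "\<dots> = inner (\<lambda>(\<sigma>, v, \<xi>). emeasure (?Q (d, \<zeta>)) A * indicator B (d, \<zeta>)) z \<xi>"
          by (rule inner_const[symmetric])
        also have "\<dots> = inner ?f2 z \<xi>"
          unfolding inner_def prod.case
          by (intro nn_integral_cong nn_integral_cong_AE eventually_mono[OF AE_subspace_lebesgue])
             (simp add: Lb \<zeta>_def)
        finally show ?thesis .
      qed
      then show ?thesis by simp
    qed
    also have "\<dots> = (\<integral>\<^sup>+ \<omega>. ?f2 (s \<omega>, x \<omega>, \<lambda>j. Xobs j \<omega>) \<partial>M)"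
      by (rule disint[symmetric]) measurable
    finally show "emeasure M {\<omega> \<in> space M. x \<omega> \<in> A \<and> (L *v x \<omega>, X \<omega>) \<in> B} =
        (\<integral>\<^sup>+ \<omega>. emeasure (?Q (L *v x \<omega>, X \<omega>)) A * indicator B (L *v x \<omega>, X \<omega>) \<partial>M)"
      by (simp add: X_def)
  qed measurable
qed

end

theorem lemma7:
  fixes A :: "real ^ 'n ^ 'n" and W V :: "real ^ 'm ^ 'n"
    and x0 :: "real ^ 'n" and y :: "nat \<Rightarrow> real ^ 'n"
    and \<alpha> \<beta> :: real
    and M :: "'w measure" and s :: "'w \<Rightarrow> real" and x :: "'w \<Rightarrow> real ^ 'n"
    and Xobs :: "'k::finite \<Rightarrow> 'w \<Rightarrow> real ^ 'n"
  defines "l \<equiv> CARD('n) - CARD('m)"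
  defines "P2 \<equiv> column_projection l y"
  defines "P1 \<equiv> mat 1 - V ** matrix_inv (transpose W ** A ** V) ** transpose W ** A"
  defines "\<Sigma>0 \<equiv> (\<lambda>\<sigma>::real. V ** transpose V + \<sigma> *\<^sub>R P2)"
  defines "X \<equiv> (\<lambda>\<omega>. (\<chi> i j. Xobs j \<omega> $ i) :: real ^ 'k ^ 'n)"
  defines "\<alpha>' \<equiv> \<alpha> + real CARD('k) * real l / 2"
  defines "\<beta>' \<equiv> (\<lambda>\<xi> :: real ^ 'k ^ 'n. \<beta> + trace (transpose \<xi> ** \<xi>) / 2)"
  defines "x' \<equiv> (\<lambda>b. x0 + (V ** matrix_inv (transpose W ** A ** V) ** transpose W) *v (b - A *v x0))"
  assumes "CARD('m) \<le> CARD('n)"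
    and "invertible A"
    and "rank W = CARD('m)" and "rank V = CARD('m)"
    and "invertible (transpose W ** A ** V)"
    and "\<forall>j<l. (transpose W ** A) *v y j = 0"
    and "inj_on y {..<l}" and "independent (y ` {..<l})"
    and "\<alpha> > 0" and "\<beta> > 0"
    and "prob_space M"
    and "distr M borel s = inv_gamma \<alpha> \<beta>"
    and "regular_cond_dist M
           (borel \<Otimes>\<^sub>M (\<Pi>\<^sub>M j\<in>UNIV. borel)) (\<lambda>\<omega>. (x \<omega>, \<lambda>j. Xobs j \<omega>))
           (restrict_space borel {0<..}) s
           (\<lambda>\<sigma>. gaussian x0 (\<Sigma>0 \<sigma>) \<Otimes>\<^sub>M
              (\<Pi>\<^sub>M j\<in>UNIV. distr (gaussian x0 (\<Sigma>0 \<sigma>)) borel (\<lambda>v. P1 *v (v - x0))))"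
  shows "regular_cond_dist M borel s borel X (\<lambda>\<xi>. inv_gamma \<alpha>' (\<beta>' \<xi>)) \<and>
    (\<exists>Q. regular_cond_dist M borel x
            (borel \<Otimes>\<^sub>M borel) (\<lambda>\<omega>. ((transpose W ** A) *v x \<omega>, X \<omega>)) Q \<and>
         (\<forall>b \<xi>. Q (transpose W *v b, \<xi>) =
            student (2 * \<alpha>') (x' b) ((\<beta>' \<xi> / \<alpha>') *\<^sub>R P2)))"
proof -
  define L where "L = transpose W ** A"
  have L_V: "transpose W ** A ** V = L ** V" by (simp add: L_def)
  have y: "\<forall>j<l. L *v y j = 0" "inj_on y {..<l}" "independent (y ` {..<l})"
    using assms by (simp_all add: L_def)
  \<comment> \<open>An orthonormal basis of the span of the columns \<open>y j\<close>; its size is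
    \<open>l\<close> because these are distinct and independent. For \<open>m = n\<close> it is
    empty.\<close>
  obtain E where E: "pairwise orthogonal E" "\<And>u. u \<in> E \<Longrightarrow> norm u = 1"
    "card E = dim (span (y ` {..<l}))" "span E = span (y ` {..<l})"
    using orthonormal_basis_subspace[of "span (y ` {..<l})"] by (metis subspace_span)
  have card_basis: "card E = l"
    using E(3) y(2,3) by (simp add: dim_eq_card_independent card_image)
  have L_span: "L *v u = 0" if "u \<in> span (y ` {..<l})" for u
    using that
  proof (induction rule: span_induct)
    case base
    then show ?case by (simp add: subspace_def matrix_vector_right_distrib matrix_vector_mult_scaleR)
  next
    case (step u)
    then show ?case using y(1) by auto
  qed
  interpret conditioned_model V L P2 E
  proof
    show "is_projection P2 E"
      unfolding P2_def using E by (intro is_projection_column_projection y) (auto simp: orthonormal_def)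
    show "card E + CARD('m) = CARD('n)"
      using card_basis \<open>CARD('m) \<le> CARD('n)\<close> by (simp add: l_def)
    show "invertible (L ** V)" using assms by (simp add: L_V)
    show "L *v u = 0" if "u \<in> span E" for u using L_span that E(4) by simp
  qed
  have "P1 = mat 1 - V ** matrix_inv (L ** V) ** L"
    by (simp add: P1_def L_def matrix_mul_assoc)
  then have P1: "oblique = P1" by (simp add: oblique_def)
  have X: "X = (\<lambda>\<omega>. matrix_of_columns (\<lambda>j. Xobs j \<omega>))"
    by (simp add: X_def matrix_of_columns_def)
  have x': "x' b = x0 + V *v (matrix_inv (L ** V) *v (transpose W *v b - L *v x0))" for b
    by (simp add: x'_def L_def matrix_vector_mul_assoc matrix_mul_assoc matrix_vector_mult_diff_distrib
        del: transpose_matrix_vector)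
  have "regular_cond_dist M
      (borel \<Otimes>\<^sub>M (\<Pi>\<^sub>M j\<in>UNIV. borel)) (\<lambda>\<omega>. (x \<omega>, \<lambda>j. Xobs j \<omega>))
      (restrict_space borel {0<..}) s
      (\<lambda>\<sigma>. prior x0 \<sigma> \<Otimes>\<^sub>M (\<Pi>\<^sub>M j\<in>UNIV. distr (prior x0 \<sigma>) borel (\<lambda>v. oblique *v (v - x0))))"
    using assms(21) unfolding \<Sigma>0_def P1 .
  note result = posterior_and_predictive[OF \<open>\<alpha> > 0\<close> \<open>\<beta> > 0\<close> \<open>prob_space M\<close>
      \<open>distr M borel s = inv_gamma \<alpha> \<beta>\<close> this]
  \<comment> \<open>The kernel is given for every value \<open>d\<close> of the conditioning vector;
    at \<open>d = transpose W *v b\<close> its location is \<open>x' b\<close>, as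
    \<open>L *v x0\<close> is \<open>transpose W *v (A *v x0)\<close>.\<close>
  let ?Q = "\<lambda>(d, \<zeta>). student (2 * \<alpha>') (x0 + V *v (matrix_inv (L ** V) *v (d - L *v x0))) ((\<beta>' \<zeta> / \<alpha>') *\<^sub>R P2)"
  have "regular_cond_dist M borel s borel X (\<lambda>\<xi>. inv_gamma \<alpha>' (\<beta>' \<xi>))"
    using result(1) unfolding X \<alpha>'_def \<beta>'_def card_basis .
  moreover have "regular_cond_dist M borel x (borel \<Otimes>\<^sub>M borel) (\<lambda>\<omega>. ((transpose W ** A) *v x \<omega>, X \<omega>)) ?Q"
    using result(2) unfolding X \<alpha>'_def \<beta>'_def card_basis L_def[symmetric] .
  moreover have "\<forall>b \<xi>. ?Q (transpose W *v b, \<xi>) = student (2 * \<alpha>') (x' b) ((\<beta>' \<xi> / \<alpha>') *\<^sub>R P2)"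
    by (simp only: prod.case x' simp_thms)
  ultimately show ?thesis by blast
qed

end
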